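(* (a) $\mathbf{HA_1}$ does not prove $\mathrm{QF\text{-}AC_{00}}$. (b) $\mathbf{IA_1}$ does not prove $\mathrm{QF\text{-}AC_{00}}$.
   Context: All systems are based on two-sorted intuitionistic predicate logic with number variables (natural numbers) and function variables (one-place number-theoretic functions); number equality is primitive. $\mathbf{IA_1}$: language with $0,',+,\cdot$ and finitely many further primitive recursive function(al) constants (exponentiation, factorial, predecessor, cut-off subtraction, min, max, $\mathrm{sg}$, $\overline{\mathrm{sg}}$, $|a-b|$, remainder, quotient, bounded sums/products/min/max of function values, prime enumeration, exponent, length, concatenation, $\overline{\alpha}(x)$, $\widetilde{\alpha}(x)$, $a\circ b$, Kleene's $\mathrm{ccp}$), application and $\lambda$-abstraction; axioms: Peano axioms for $0,',+,\cdot$, equality axioms, defining equations, $x=y\to\alpha(x)=\alpha(y)$, $\lambda$-conversion $(\lambda x.t(x))(s)=t(s)$, induction for all formulas. $\mathbf{HA_1}$: $0$, a constant for each primitive recursive description, application, $\lambda$, recursor $\mathrm{rec}$; axioms $x=x$, $A(x)\,\&\,x=y\to A(y)$, induction, $\neg S(0)=0$, defining equations, $\lambda$-conversion, $\mathrm{rec}(t,u,0)=t$, $\mathrm{rec}(t,u,S(s))=u(\langle\mathrm{rec}(t,u,s),s\rangle)$ with $\langle a,b\rangle=2^a3^b$. $\mathrm{QF\text{-}AC_{00}}$: $\forall x\exists y\,A(x,y)\to\exists\alpha\forall x\,A(x,\alpha(x))$ for quantifier-free $A$ not containing $\alpha$. *)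

theory Defs
  imports Main
begin

section \<open>Two-sorted syntax\<close>

text \<open>
  A constant \<open>c\<close> takes number arguments and function arguments; its arity is a pair \<open>(k, l)\<close>
  of their numbers. As in Kleene and Vesley, a constant of arity \<open>(1, 0)\<close> is itself a functor,
  and \<open>c(t)\<close> is the application of that functor to \<open>t\<close>; all other constants form terms through
  \<open>Con c ts us\<close>. The only equality is the one between numbers.
\<close>

datatype 'c tm =
    NVar nat
  | Zero
  | Con 'c "'c tm list" "'c fn list"
  | App "'c fn" "'c tm"
and 'c fn =
    FVar nat
  | FCon 'c
  | Lam nat "'c tm"

datatype 'c fm =
    Eq "'c tm" "'c tm"
  | And "'c fm" "'c fm"
  | Or "'c fm" "'c fm"
  | Imp "'c fm" "'c fm"
  | Not "'c fm"
  | AllN nat "'c fm"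
  | ExN nat "'c fm"
  | AllF nat "'c fm"
  | ExF nat "'c fm"

text \<open>Arities; \<open>None\<close> means that the constant does not belong to the language.\<close>

type_synonym 'c arity = "'c \<Rightarrow> (nat \<times> nat) option"

fun wf_tm :: "'c arity \<Rightarrow> 'c tm \<Rightarrow> bool"
  and wf_fn :: "'c arity \<Rightarrow> 'c fn \<Rightarrow> bool" where
  "wf_tm ar (NVar x) = True"
| "wf_tm ar Zero = True"
| "wf_tm ar (Con c ts us) =
    (ar c = Some (length ts, length us) \<and> ar c \<noteq> Some (1, 0) \<and>
     (\<forall>t\<in>set ts. wf_tm ar t) \<and> (\<forall>u\<in>set us. wf_fn ar u))"
| "wf_tm ar (App u t) = (wf_fn ar u \<and> wf_tm ar t)"
| "wf_fn ar (FVar a) = True"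
| "wf_fn ar (FCon c) = (ar c = Some (1, 0))"
| "wf_fn ar (Lam x t) = wf_tm ar t"

fun wf_fm :: "'c arity \<Rightarrow> 'c fm \<Rightarrow> bool" where
  "wf_fm ar (Eq s t) = (wf_tm ar s \<and> wf_tm ar t)"
| "wf_fm ar (And A B) = (wf_fm ar A \<and> wf_fm ar B)"
| "wf_fm ar (Or A B) = (wf_fm ar A \<and> wf_fm ar B)"
| "wf_fm ar (Imp A B) = (wf_fm ar A \<and> wf_fm ar B)"
| "wf_fm ar (Not A) = wf_fm ar A"
| "wf_fm ar (AllN x A) = wf_fm ar A"
| "wf_fm ar (ExN x A) = wf_fm ar A"
| "wf_fm ar (AllF a A) = wf_fm ar A"
| "wf_fm ar (ExF a A) = wf_fm ar A"

text \<open>Application of a constant to arguments, whichever of the two term forms applies.\<close>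

definition capp :: "'c arity \<Rightarrow> 'c \<Rightarrow> 'c tm list \<Rightarrow> 'c fn list \<Rightarrow> 'c tm" where
  "capp ar c ts us = (if ar c = Some (1, 0) then App (FCon c) (hd ts) else Con c ts us)"

subsection \<open>Free variables and substitution\<close>

datatype var = NV nat | FV nat

fun fv_tm :: "'c tm \<Rightarrow> var set" and fv_fn :: "'c fn \<Rightarrow> var set" where
  "fv_tm (NVar x) = {NV x}"
| "fv_tm Zero = {}"
| "fv_tm (Con c ts us) = (\<Union>t\<in>set ts. fv_tm t) \<union> (\<Union>u\<in>set us. fv_fn u)"
| "fv_tm (App u t) = fv_fn u \<union> fv_tm t"
| "fv_fn (FVar a) = {FV a}"
| "fv_fn (FCon c) = {}"
| "fv_fn (Lam x t) = fv_tm t - {NV x}"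

fun fv :: "'c fm \<Rightarrow> var set" where
  "fv (Eq s t) = fv_tm s \<union> fv_tm t"
| "fv (And A B) = fv A \<union> fv B"
| "fv (Or A B) = fv A \<union> fv B"
| "fv (Imp A B) = fv A \<union> fv B"
| "fv (Not A) = fv A"
| "fv (AllN x A) = fv A - {NV x}"
| "fv (ExN x A) = fv A - {NV x}"
| "fv (AllF a A) = fv A - {FV a}"
| "fv (ExF a A) = fv A - {FV a}"

text \<open>
  Substitution of a term for a number variable and of a functor for a function variable. It
  replaces the free occurrences and renames nothing, so every use below carries a \<open>free_for\<close>
  condition, unless capture is impossible.
\<close>

fun sbn_tm :: "nat \<Rightarrow> 'c tm \<Rightarrow> 'c tm \<Rightarrow> 'c tm"
  and sbn_fn :: "nat \<Rightarrow> 'c tm \<Rightarrow> 'c fn \<Rightarrow> 'c fn" where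
  "sbn_tm x s (NVar y) = (if y = x then s else NVar y)"
| "sbn_tm x s Zero = Zero"
| "sbn_tm x s (Con c ts us) = Con c (map (sbn_tm x s) ts) (map (sbn_fn x s) us)"
| "sbn_tm x s (App u t) = App (sbn_fn x s u) (sbn_tm x s t)"
| "sbn_fn x s (FVar a) = FVar a"
| "sbn_fn x s (FCon c) = FCon c"
| "sbn_fn x s (Lam y t) = Lam y (if y = x then t else sbn_tm x s t)"

fun sbn :: "nat \<Rightarrow> 'c tm \<Rightarrow> 'c fm \<Rightarrow> 'c fm" where
  "sbn x s (Eq t r) = Eq (sbn_tm x s t) (sbn_tm x s r)"
| "sbn x s (And A B) = And (sbn x s A) (sbn x s B)"
| "sbn x s (Or A B) = Or (sbn x s A) (sbn x s B)"
| "sbn x s (Imp A B) = Imp (sbn x s A) (sbn x s B)"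
| "sbn x s (Not A) = Not (sbn x s A)"
| "sbn x s (AllN y A) = AllN y (if y = x then A else sbn x s A)"
| "sbn x s (ExN y A) = ExN y (if y = x then A else sbn x s A)"
| "sbn x s (AllF a A) = AllF a (sbn x s A)"
| "sbn x s (ExF a A) = ExF a (sbn x s A)"

fun sbf_tm :: "nat \<Rightarrow> 'c fn \<Rightarrow> 'c tm \<Rightarrow> 'c tm"
  and sbf_fn :: "nat \<Rightarrow> 'c fn \<Rightarrow> 'c fn \<Rightarrow> 'c fn" where
  "sbf_tm a v (NVar y) = NVar y"
| "sbf_tm a v Zero = Zero"
| "sbf_tm a v (Con c ts us) = Con c (map (sbf_tm a v) ts) (map (sbf_fn a v) us)"
| "sbf_tm a v (App u t) = App (sbf_fn a v u) (sbf_tm a v t)"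
| "sbf_fn a v (FVar b) = (if b = a then v else FVar b)"
| "sbf_fn a v (FCon c) = FCon c"
| "sbf_fn a v (Lam y t) = Lam y (sbf_tm a v t)"

fun sbf :: "nat \<Rightarrow> 'c fn \<Rightarrow> 'c fm \<Rightarrow> 'c fm" where
  "sbf a v (Eq t r) = Eq (sbf_tm a v t) (sbf_tm a v r)"
| "sbf a v (And A B) = And (sbf a v A) (sbf a v B)"
| "sbf a v (Or A B) = Or (sbf a v A) (sbf a v B)"
| "sbf a v (Imp A B) = Imp (sbf a v A) (sbf a v B)"
| "sbf a v (Not A) = Not (sbf a v A)"
| "sbf a v (AllN y A) = AllN y (sbf a v A)"
| "sbf a v (ExN y A) = ExN y (sbf a v A)"
| "sbf a v (AllF b A) = AllF b (if b = a then A else sbf a v A)"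
| "sbf a v (ExF b A) = ExF b (if b = a then A else sbf a v A)"

text \<open>
  \<open>free_for v V A\<close>: no free occurrence of \<open>v\<close> in \<open>A\<close> lies in the scope of a binder for a
  variable in \<open>V\<close>. A term or functor \<open>e\<close> is free for \<open>v\<close> in \<open>A\<close> if this holds with \<open>V\<close> the
  set of free variables of \<open>e\<close>.
\<close>

fun free_for_tm :: "var \<Rightarrow> var set \<Rightarrow> 'c tm \<Rightarrow> bool"
  and free_for_fn :: "var \<Rightarrow> var set \<Rightarrow> 'c fn \<Rightarrow> bool" where
  "free_for_tm v V (NVar y) = True"
| "free_for_tm v V Zero = True"
| "free_for_tm v V (Con c ts us) =
    ((\<forall>t\<in>set ts. free_for_tm v V t) \<and> (\<forall>u\<in>set us. free_for_fn v V u))"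
| "free_for_tm v V (App u t) = (free_for_fn v V u \<and> free_for_tm v V t)"
| "free_for_fn v V (FVar b) = True"
| "free_for_fn v V (FCon c) = True"
| "free_for_fn v V (Lam y t) =
    (v \<in> fv_tm t - {NV y} \<longrightarrow> NV y \<notin> V \<and> free_for_tm v V t)"

fun free_for :: "var \<Rightarrow> var set \<Rightarrow> 'c fm \<Rightarrow> bool" where
  "free_for v V (Eq t r) = (free_for_tm v V t \<and> free_for_tm v V r)"
| "free_for v V (And A B) = (free_for v V A \<and> free_for v V B)"
| "free_for v V (Or A B) = (free_for v V A \<and> free_for v V B)"
| "free_for v V (Imp A B) = (free_for v V A \<and> free_for v V B)"
| "free_for v V (Not A) = free_for v V A"
| "free_for v V (AllN y A) = (v \<in> fv A - {NV y} \<longrightarrow> NV y \<notin> V \<and> free_for v V A)"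
| "free_for v V (ExN y A) = (v \<in> fv A - {NV y} \<longrightarrow> NV y \<notin> V \<and> free_for v V A)"
| "free_for v V (AllF b A) = (v \<in> fv A - {FV b} \<longrightarrow> FV b \<notin> V \<and> free_for v V A)"
| "free_for v V (ExF b A) = (v \<in> fv A - {FV b} \<longrightarrow> FV b \<notin> V \<and> free_for v V A)"

section \<open>Intuitionistic two-sorted predicate logic\<close>

text \<open>
  Kleene's Hilbert-style postulates, over the well-formed formulas of the language given by
  \<open>ar\<close>, with non-logical axioms \<open>Ax\<close>. There are no hypotheses besides the axioms, whose free
  variables are read universally.
\<close>

inductive proves :: "'c arity \<Rightarrow> 'c fm set \<Rightarrow> 'c fm \<Rightarrow> bool"
  for ar :: "'c arity" and Ax :: "'c fm set" where
  ax: "A \<in> Ax \<Longrightarrow> wf_fm ar A \<Longrightarrow> proves ar Ax A"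
| mp: "proves ar Ax A \<Longrightarrow> proves ar Ax (Imp A B) \<Longrightarrow> proves ar Ax B"
| imp_k: "wf_fm ar A \<Longrightarrow> wf_fm ar B \<Longrightarrow> proves ar Ax (Imp A (Imp B A))"
| imp_s: "wf_fm ar A \<Longrightarrow> wf_fm ar B \<Longrightarrow> wf_fm ar C \<Longrightarrow>
    proves ar Ax (Imp (Imp A B) (Imp (Imp A (Imp B C)) (Imp A C)))"
| and_i: "wf_fm ar A \<Longrightarrow> wf_fm ar B \<Longrightarrow> proves ar Ax (Imp A (Imp B (And A B)))"
| and_e1: "wf_fm ar A \<Longrightarrow> wf_fm ar B \<Longrightarrow> proves ar Ax (Imp (And A B) A)"
| and_e2: "wf_fm ar A \<Longrightarrow> wf_fm ar B \<Longrightarrow> proves ar Ax (Imp (And A B) B)"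
| or_i1: "wf_fm ar A \<Longrightarrow> wf_fm ar B \<Longrightarrow> proves ar Ax (Imp A (Or A B))"
| or_i2: "wf_fm ar A \<Longrightarrow> wf_fm ar B \<Longrightarrow> proves ar Ax (Imp B (Or A B))"
| or_e: "wf_fm ar A \<Longrightarrow> wf_fm ar B \<Longrightarrow> wf_fm ar C \<Longrightarrow>
    proves ar Ax (Imp (Imp A C) (Imp (Imp B C) (Imp (Or A B) C)))"
| not_i: "wf_fm ar A \<Longrightarrow> wf_fm ar B \<Longrightarrow>
    proves ar Ax (Imp (Imp A B) (Imp (Imp A (Not B)) (Not A)))"
| not_e: "wf_fm ar A \<Longrightarrow> wf_fm ar B \<Longrightarrow> proves ar Ax (Imp (Not A) (Imp A B))"
| allN_i: "proves ar Ax (Imp C A) \<Longrightarrow> NV x \<notin> fv C \<Longrightarrow> proves ar Ax (Imp C (AllN x A))"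
| allN_e: "wf_fm ar A \<Longrightarrow> wf_tm ar t \<Longrightarrow> free_for (NV x) (fv_tm t) A \<Longrightarrow>
    proves ar Ax (Imp (AllN x A) (sbn x t A))"
| exN_i: "wf_fm ar A \<Longrightarrow> wf_tm ar t \<Longrightarrow> free_for (NV x) (fv_tm t) A \<Longrightarrow>
    proves ar Ax (Imp (sbn x t A) (ExN x A))"
| exN_e: "proves ar Ax (Imp A C) \<Longrightarrow> NV x \<notin> fv C \<Longrightarrow> proves ar Ax (Imp (ExN x A) C)"
| allF_i: "proves ar Ax (Imp C A) \<Longrightarrow> FV a \<notin> fv C \<Longrightarrow> proves ar Ax (Imp C (AllF a A))"
| allF_e: "wf_fm ar A \<Longrightarrow> wf_fn ar u \<Longrightarrow> free_for (FV a) (fv_fn u) A \<Longrightarrow>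
    proves ar Ax (Imp (AllF a A) (sbf a u A))"
| exF_i: "wf_fm ar A \<Longrightarrow> wf_fn ar u \<Longrightarrow> free_for (FV a) (fv_fn u) A \<Longrightarrow>
    proves ar Ax (Imp (sbf a u A) (ExF a A))"
| exF_e: "proves ar Ax (Imp A C) \<Longrightarrow> FV a \<notin> fv C \<Longrightarrow> proves ar Ax (Imp (ExF a A) C)"

section \<open>Schemata\<close>

text \<open>Axiom schemata shared by both systems; \<open>S\<close> is the functor for the successor.\<close>

definition induction_schema :: "'c fn \<Rightarrow> 'c fm set" where
  "induction_schema S =
    {Imp (And (sbn x Zero A) (AllN x (Imp A (sbn x (App S (NVar x)) A)))) A | x A. True}"

definition lambda_conversion :: "'c fm set" where
  "lambda_conversion =
    {Eq (App (Lam x t) s) (sbn_tm x s t) | x t s. free_for_tm (NV x) (fv_tm s) t}"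

fun quantifier_free :: "'c fm \<Rightarrow> bool" where
  "quantifier_free (Eq s t) = True"
| "quantifier_free (And A B) = (quantifier_free A \<and> quantifier_free B)"
| "quantifier_free (Or A B) = (quantifier_free A \<and> quantifier_free B)"
| "quantifier_free (Imp A B) = (quantifier_free A \<and> quantifier_free B)"
| "quantifier_free (Not A) = quantifier_free A"
| "quantifier_free (AllN x A) = False"
| "quantifier_free (ExN x A) = False"
| "quantifier_free (AllF a A) = False"
| "quantifier_free (ExF a A) = False"

text \<open>
  \<open>A\<close> may contain further number and function variables as parameters. A quantifier-free
  formula binds no function variable, so not containing \<open>\<alpha>\<close> is the same as \<open>\<alpha>\<close> not being free.
\<close>

definition QF_AC00 :: "'c arity \<Rightarrow> 'c fm set" where
  "QF_AC00 ar =
    {Imp (AllN x (ExN y A)) (ExF a (AllN x (sbn y (App (FVar a) (NVar x)) A))) | x y a A.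
      wf_fm ar A \<and> quantifier_free A \<and> x \<noteq> y \<and> FV a \<notin> fv A \<and>
      free_for (NV y) {NV x, FV a} A}"

section \<open>The system $\mathbf{HA_1}$\<close>

text \<open>Descriptions of primitive recursive functions of any number of arguments, including 0.\<close>

datatype prd =
    PZero nat
  | PSuc
  | PProj nat nat
  | PComp nat prd "prd list"
  | PRec prd prd

fun prd_arity :: "prd \<Rightarrow> nat option" where
  "prd_arity (PZero n) = Some n"
| "prd_arity PSuc = Some 1"
| "prd_arity (PProj n i) = (if i < n then Some n else None)"
| "prd_arity (PComp n h gs) =
    (if prd_arity h = Some (length gs) \<and> (\<forall>g\<in>set gs. prd_arity g = Some n)
     then Some n else None)"
| "prd_arity (PRec f g) =
    (case prd_arity f of
       None \<Rightarrow> None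
     | Some n \<Rightarrow> if prd_arity g = Some (n + 2) then Some (n + 1) else None)"

datatype ha_const = Prim prd | RecC

fun ha_arity :: "ha_const arity" where
  "ha_arity (Prim d) = map_option (\<lambda>n. (n, 0)) (prd_arity d)"
| "ha_arity RecC = Some (2, 1)"

abbreviation papp :: "prd \<Rightarrow> ha_const tm list \<Rightarrow> ha_const tm" where
  "papp d ts \<equiv> capp ha_arity (Prim d) ts []"

abbreviation ha_suc :: "ha_const tm \<Rightarrow> ha_const tm" where
  "ha_suc t \<equiv> App (FCon (Prim PSuc)) t"

abbreviation ha_rec :: "ha_const tm \<Rightarrow> ha_const fn \<Rightarrow> ha_const tm \<Rightarrow> ha_const tm" where
  "ha_rec t u s \<equiv> Con RecC [t, s] [u]"

fun prd_eqs :: "prd \<Rightarrow> ha_const fm set" where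
  "prd_eqs (PZero n) = {Eq (papp (PZero n) (map NVar [0..<n])) Zero}"
| "prd_eqs PSuc = {}"
| "prd_eqs (PProj n i) = {Eq (papp (PProj n i) (map NVar [0..<n])) (NVar i)}"
| "prd_eqs (PComp n h gs) =
    (let xs = map NVar [0..<n]
     in {Eq (papp (PComp n h gs) xs) (papp h (map (\<lambda>g. papp g xs) gs))})"
| "prd_eqs (PRec f g) =
    (let y = NVar 0; xs = map NVar [1..<Suc (the (prd_arity f))]
     in {Eq (papp (PRec f g) (Zero # xs)) (papp f xs),
         Eq (papp (PRec f g) (ha_suc y # xs)) (papp g (y # papp (PRec f g) (y # xs) # xs))})"

text \<open>Descriptions with value \<open>y + x\<close>, \<open>y * x\<close> and \<open>x ^ y\<close> at the arguments \<open>y\<close>, \<open>x\<close>.\<close>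

definition prd_add :: prd where
  "prd_add = PRec (PProj 1 0) (PComp 3 PSuc [PProj 3 1])"

definition prd_mul :: prd where
  "prd_mul = PRec (PZero 1) (PComp 3 prd_add [PProj 3 1, PProj 3 2])"

definition prd_exp :: prd where
  "prd_exp = PRec (PComp 1 PSuc [PZero 1]) (PComp 3 prd_mul [PProj 3 1, PProj 3 2])"

text \<open>The pairing \<open>2 ^ a * 3 ^ b\<close>.\<close>

definition ha_pair :: "ha_const tm \<Rightarrow> ha_const tm \<Rightarrow> ha_const tm" where
  "ha_pair a b =
    papp prd_mul [papp prd_exp [a, ha_suc (ha_suc Zero)],
                  papp prd_exp [b, ha_suc (ha_suc (ha_suc Zero))]]"

definition HA1_axioms :: "ha_const fm set" where
  "HA1_axioms =
    {Eq (NVar x) (NVar x) | x. True} \<union>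
    {Imp (And A (Eq (NVar x) (NVar y))) (sbn x (NVar y) A) | x y A. free_for (NV x) {NV y} A} \<union>
    induction_schema (FCon (Prim PSuc)) \<union>
    {Not (Eq (ha_suc Zero) Zero)} \<union>
    (\<Union>d. prd_eqs d) \<union>
    lambda_conversion \<union>
    {Eq (ha_rec t u Zero) t | t u. True} \<union>
    {Eq (ha_rec t u (ha_suc s)) (App u (ha_pair (ha_rec t u s) s)) | t u s. True}"

abbreviation HA1_proves :: "ha_const fm \<Rightarrow> bool" where
  "HA1_proves \<equiv> proves ha_arity HA1_axioms"

section \<open>The system $\mathbf{IA_1}$\<close>

text \<open>
  The constants, with \<open>SumC\<close>, \<open>ProdC\<close> for sums and products over \<open>y < b\<close>, \<open>MinC\<close>, \<open>MaxC\<close> for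
  minima and maxima over \<open>y \<le> b\<close>, \<open>PrimeC\<close> for the enumeration \<open>p\<^sub>0 = 2, p\<^sub>1 = 3, ...\<close>, \<open>ExptC\<close>
  for the exponent \<open>(a)\<^sub>i\<close> of \<open>p\<^sub>i\<close> in \<open>a\<close>, \<open>LhC\<close> for the number of nonzero exponents,
  \<open>CatC\<close> for concatenation, \<open>BarC\<close> for the code of \<open>\<alpha>(0) + 1, ..., \<alpha>(x - 1) + 1\<close>, \<open>TildeC\<close> for
  that of \<open>\<alpha>(0), ..., \<alpha>(x - 1)\<close>, and \<open>CircC\<close> for \<open>a \<circ> b\<close>.
\<close>

datatype ia_const =
    SucC | PlusC | TimesC | ExpC | FactC | PredC | MonusC | Min2C | Max2C | SgC | SgBarC | DistC
  | RmC | QuotC | SumC | ProdC | MinC | MaxC | PrimeC | ExptC | LhC | CatC | BarC | TildeC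
  | CircC | CcpC

text \<open>The arity of \<open>CcpC\<close> is a parameter; \<open>None\<close> gives the language without \<open>CcpC\<close>.\<close>

fun ia_arity :: "(nat \<times> nat) option \<Rightarrow> ia_const arity" where
  "ia_arity kl SucC = Some (1, 0)"
| "ia_arity kl PlusC = Some (2, 0)"
| "ia_arity kl TimesC = Some (2, 0)"
| "ia_arity kl ExpC = Some (2, 0)"
| "ia_arity kl FactC = Some (1, 0)"
| "ia_arity kl PredC = Some (1, 0)"
| "ia_arity kl MonusC = Some (2, 0)"
| "ia_arity kl Min2C = Some (2, 0)"
| "ia_arity kl Max2C = Some (2, 0)"
| "ia_arity kl SgC = Some (1, 0)"
| "ia_arity kl SgBarC = Some (1, 0)"
| "ia_arity kl DistC = Some (2, 0)"
| "ia_arity kl RmC = Some (2, 0)"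
| "ia_arity kl QuotC = Some (2, 0)"
| "ia_arity kl SumC = Some (1, 1)"
| "ia_arity kl ProdC = Some (1, 1)"
| "ia_arity kl MinC = Some (1, 1)"
| "ia_arity kl MaxC = Some (1, 1)"
| "ia_arity kl PrimeC = Some (1, 0)"
| "ia_arity kl ExptC = Some (2, 0)"
| "ia_arity kl LhC = Some (1, 0)"
| "ia_arity kl CatC = Some (2, 0)"
| "ia_arity kl BarC = Some (1, 1)"
| "ia_arity kl TildeC = Some (1, 1)"
| "ia_arity kl CircC = Some (2, 0)"
| "ia_arity kl CcpC = kl"

type_synonym ia_tm = "ia_const tm"

abbreviation ia_ap1 :: "ia_const \<Rightarrow> ia_tm \<Rightarrow> ia_tm" where
  "ia_ap1 c s \<equiv> App (FCon c) s"

abbreviation ia_ap2 :: "ia_const \<Rightarrow> ia_tm \<Rightarrow> ia_tm \<Rightarrow> ia_tm" where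
  "ia_ap2 c s t \<equiv> Con c [s, t] []"

text \<open>\<open>SumC\<close>, \<open>ProdC\<close>, \<open>MinC\<close>, \<open>MaxC\<close>, \<open>BarC\<close>, \<open>TildeC\<close> with bound \<open>s\<close> and functor \<open>u\<close>\<close>

abbreviation ia_bd :: "ia_const \<Rightarrow> ia_tm \<Rightarrow> ia_const fn \<Rightarrow> ia_tm" where
  "ia_bd c s u \<equiv> Con c [s] [u]"

abbreviation ia_suc :: "ia_tm \<Rightarrow> ia_tm" where
  "ia_suc \<equiv> ia_ap1 SucC"

abbreviation ia_plus :: "ia_tm \<Rightarrow> ia_tm \<Rightarrow> ia_tm" where
  "ia_plus \<equiv> ia_ap2 PlusC"

abbreviation ia_times :: "ia_tm \<Rightarrow> ia_tm \<Rightarrow> ia_tm" where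
  "ia_times \<equiv> ia_ap2 TimesC"

abbreviation ia_monus :: "ia_tm \<Rightarrow> ia_tm \<Rightarrow> ia_tm" where
  "ia_monus \<equiv> ia_ap2 MonusC"

abbreviation ia_one :: ia_tm where
  "ia_one \<equiv> ia_suc Zero"

abbreviation ia_two :: ia_tm where
  "ia_two \<equiv> ia_suc ia_one"

text \<open>
  The bounded least number operator: the least \<open>y < b\<close> with \<open>r = 0\<close>, and \<open>b\<close> if there is none,
  is the sum over \<open>t < b\<close> of the product over \<open>y \<le> t\<close> of \<open>sg(r)\<close>. Here \<open>t\<close> has to be distinct
  from \<open>y\<close> and not free in \<open>r\<close>.
\<close>

definition ia_mu :: "nat \<Rightarrow> nat \<Rightarrow> ia_tm \<Rightarrow> ia_tm \<Rightarrow> ia_tm" where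
  "ia_mu t y b r =
    ia_bd SumC b (Lam t (ia_bd ProdC (ia_suc (NVar t)) (Lam y (ia_ap1 SgC r))))"

text \<open>
  Zero iff \<open>p < b\<close> and \<open>b\<close> is prime, i.e. iff \<open>p < b\<close> and exactly two of \<open>1, ..., b\<close> divide
  \<open>b\<close>. The variable \<open>c\<close> must not be free in \<open>b\<close>.
\<close>

definition ia_prime_above :: "nat \<Rightarrow> ia_tm \<Rightarrow> ia_tm \<Rightarrow> ia_tm" where
  "ia_prime_above c p b =
    ia_plus (ia_monus (ia_suc p) b)
      (ia_ap2 DistC
        (ia_bd SumC b (Lam c (ia_ap1 SgBarC (ia_ap2 RmC b (ia_suc (NVar c)))))) ia_two)"

definition ia_def_eqs :: "ia_const fm set" where
  "ia_def_eqs =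
    (let a = NVar 0; b = NVar 1; i = NVar 2; y = NVar 3; al = FVar 0 in
     {Eq (ia_plus a Zero) a,
      Eq (ia_plus a (ia_suc b)) (ia_suc (ia_plus a b)),
      Eq (ia_times a Zero) Zero,
      Eq (ia_times a (ia_suc b)) (ia_plus (ia_times a b) a),
      Eq (ia_ap2 ExpC a Zero) ia_one,
      Eq (ia_ap2 ExpC a (ia_suc b)) (ia_times (ia_ap2 ExpC a b) a),
      Eq (ia_ap1 FactC Zero) ia_one,
      Eq (ia_ap1 FactC (ia_suc a)) (ia_times (ia_ap1 FactC a) (ia_suc a)),
      Eq (ia_ap1 PredC Zero) Zero,
      Eq (ia_ap1 PredC (ia_suc a)) a,
      Eq (ia_monus a Zero) a,
      Eq (ia_monus a (ia_suc b)) (ia_ap1 PredC (ia_monus a b)),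
      Eq (ia_ap2 Min2C a b) (ia_monus b (ia_monus b a)),
      Eq (ia_ap2 Max2C a b) (ia_plus (ia_monus a b) b),
      Eq (ia_ap1 SgC Zero) Zero,
      Eq (ia_ap1 SgC (ia_suc a)) ia_one,
      Eq (ia_ap1 SgBarC Zero) ia_one,
      Eq (ia_ap1 SgBarC (ia_suc a)) Zero,
      Eq (ia_ap2 DistC a b) (ia_plus (ia_monus a b) (ia_monus b a)),
      Eq (ia_ap2 RmC Zero b) Zero,
      Eq (ia_ap2 RmC (ia_suc a) b)
        (ia_times (ia_suc (ia_ap2 RmC a b))
                  (ia_ap1 SgC (ia_ap2 DistC b (ia_suc (ia_ap2 RmC a b))))),
      Eq (ia_ap2 QuotC Zero b) Zero,
      Eq (ia_ap2 QuotC (ia_suc a) b)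
        (ia_plus (ia_ap2 QuotC a b)
                 (ia_ap1 SgBarC (ia_ap2 DistC b (ia_suc (ia_ap2 RmC a b))))),
      Eq (ia_bd SumC Zero al) Zero,
      Eq (ia_bd SumC (ia_suc b) al) (ia_plus (ia_bd SumC b al) (App al b)),
      Eq (ia_bd ProdC Zero al) ia_one,
      Eq (ia_bd ProdC (ia_suc b) al) (ia_times (ia_bd ProdC b al) (App al b)),
      Eq (ia_bd MinC Zero al) (App al Zero),
      Eq (ia_bd MinC (ia_suc b) al) (ia_ap2 Min2C (ia_bd MinC b al) (App al (ia_suc b))),
      Eq (ia_bd MaxC Zero al) (App al Zero),
      Eq (ia_bd MaxC (ia_suc b) al) (ia_ap2 Max2C (ia_bd MaxC b al) (App al (ia_suc b))),
      Eq (ia_ap1 PrimeC Zero) ia_two,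
      Eq (ia_ap1 PrimeC (ia_suc i))
        (ia_mu 4 3 (ia_plus (ia_ap1 FactC (ia_ap1 PrimeC i)) ia_two)
          (ia_prime_above 5 (ia_ap1 PrimeC i) y)),
      Eq (ia_ap2 ExptC a i)
        (ia_mu 4 3 a
          (ia_plus (ia_ap2 RmC a (ia_ap2 ExpC (ia_ap1 PrimeC i) y))
            (ia_ap1 SgBarC (ia_ap2 RmC a (ia_ap2 ExpC (ia_ap1 PrimeC i) (ia_suc y)))))),
      Eq (ia_ap1 LhC a) (ia_bd SumC a (Lam 2 (ia_ap1 SgC (ia_ap2 ExptC a i)))),
      Eq (ia_ap2 CatC a b)
        (ia_times a
          (ia_bd ProdC (ia_ap1 LhC b)
            (Lam 2 (ia_ap2 ExpC (ia_ap1 PrimeC (ia_plus (ia_ap1 LhC a) i)) (ia_ap2 ExptC b i))))),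
      Eq (ia_bd BarC b al)
        (ia_bd ProdC b (Lam 2 (ia_ap2 ExpC (ia_ap1 PrimeC i) (ia_suc (App al i))))),
      Eq (ia_bd TildeC b al)
        (ia_bd ProdC b (Lam 2 (ia_ap2 ExpC (ia_ap1 PrimeC i) (App al i)))),
      Eq (ia_ap2 CircC a b)
        (ia_bd ProdC (ia_ap2 Max2C a b)
          (Lam 2 (ia_ap2 ExpC (ia_ap1 PrimeC i)
                    (ia_ap2 Max2C (ia_ap2 ExptC a i) (ia_ap2 ExptC b i)))))})"

text \<open>
  Kleene's two forms for introducing a primitive recursive function constant \<open>f\<close> in terms of
  earlier ones, with number parameters \<open>x\<^sub>1, ..., x\<^sub>k\<close> and function parameters
  \<open>\<alpha>\<^sub>0, ..., \<alpha>\<^bsub>l-1\<^esub>\<close>. In \<open>Explicit k l p\<close>, \<open>f(x, \<alpha>) = p\<close>. In \<open>PrimRec k l p q\<close>,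
  \<open>f(0, x, \<alpha>) = p\<close> and \<open>f(y', x, \<alpha>) = q(y, f(y, x, \<alpha>), x, \<alpha>)\<close>, where \<open>y\<close> is variable 0 and
  variable \<open>k + 1\<close> of \<open>q\<close> stands for \<open>f(y, x, \<alpha>)\<close>.
\<close>

datatype ia_def =
    Explicit nat nat ia_tm
  | PrimRec nat nat ia_tm ia_tm

fun def_arity :: "ia_def \<Rightarrow> nat \<times> nat" where
  "def_arity (Explicit k l p) = (k, l)"
| "def_arity (PrimRec k l p q) = (Suc k, l)"

fun def_admissible :: "ia_def \<Rightarrow> bool" where
  "def_admissible (Explicit k l p) =
    (wf_tm (ia_arity None) p \<and> fv_tm p \<subseteq> NV ` {1..k} \<union> FV ` {..<l})"
| "def_admissible (PrimRec k l p q) =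
    (wf_tm (ia_arity None) p \<and> fv_tm p \<subseteq> NV ` {1..k} \<union> FV ` {..<l} \<and>
     wf_tm (ia_arity None) q \<and> fv_tm q \<subseteq> NV ` {0..k + 1} \<union> FV ` {..<l} \<and>
     free_for_tm (NV (k + 1)) (NV ` {0..k}) q)"

definition ccp_app :: "ia_def \<Rightarrow> ia_tm list \<Rightarrow> ia_tm" where
  "ccp_app d ts =
    capp (ia_arity (Some (def_arity d))) CcpC ts (map FVar [0..<snd (def_arity d)])"

fun def_eqs :: "ia_def \<Rightarrow> ia_const fm set" where
  "def_eqs (Explicit k l p) =
    {Eq (ccp_app (Explicit k l p) (map NVar [1..<Suc k])) p}"
| "def_eqs (PrimRec k l p q) =
    (let f = ccp_app (PrimRec k l p q); xs = map NVar [1..<Suc k]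
     in {Eq (f (Zero # xs)) p,
         Eq (f (ia_suc (NVar 0) # xs)) (sbn_tm (k + 1) (f (NVar 0 # xs)) q)})"

text \<open>
  The definition \<open>d\<close> that introduces Kleene's constant \<open>ccp\<close> is a parameter, to be constrained
  only by \<open>def_admissible d\<close>; a statement for all such \<open>d\<close> covers Kleene's own definition.
\<close>

definition IA1_axioms :: "ia_def \<Rightarrow> ia_const fm set" where
  "IA1_axioms d =
    (let x = NVar 0; y = NVar 1; z = NVar 2; al = FVar 0 in
     {Imp (Eq (ia_suc x) (ia_suc y)) (Eq x y),
      Not (Eq (ia_suc x) Zero),
      Eq x x,
      Imp (Eq x y) (Imp (Eq x z) (Eq y z)),
      Imp (Eq x y) (Eq (ia_suc x) (ia_suc y)),
      Imp (Eq x y) (Eq (App al x) (App al y))}) \<union>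
    ia_def_eqs \<union> def_eqs d \<union> lambda_conversion \<union> induction_schema (FCon SucC)"

abbreviation IA1_proves :: "ia_def \<Rightarrow> ia_const fm \<Rightarrow> bool" where
  "IA1_proves d \<equiv> proves (ia_arity (Some (def_arity d))) (IA1_axioms d)"

end

(*
  The countermodel has the standard numbers and, as functions, all functions that are bounded by
  some level of a fast-growing hierarchy. All functionals of the two systems preserve such bounds,
  so that the axioms hold. The diagonal function of the hierarchy is not in the model, but a left
  inverse of it is, since that can be chosen below the identity; this left inverse is onto, and
  choosing preimages under it would give back the diagonal function.
*)

theory Submission
  imports Defs
begin

section \<open>A fast-growing hierarchy\<close>

text \<open>Membership in the class of functions depends on growth alone. Hence the left inverse
  belongs to it whatever its complexity; in a model made of, say, the primitive recursive functions
  one would have to show that it is primitive recursive. The price is a closure proof for all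
  functionals of the languages, including the recursor. Here lambda terms with number parameters are
  the obstacle: no fixed \<open>j\<close> gives \<open>u n \<le> hier j n\<close> for all values of
  the parameters, as constant functions show. Bounds therefore have the form
  \<open>hier j (max M n)\<close>, with \<open>M\<close> a bound on the numbers involved and
  \<open>j\<close> independent of \<open>M\<close>; only for a single functor under a fixed
  assignment is \<open>M\<close> absorbed into the level. The hierarchy is made for this: one more
  level pays for a composition, and also for a recursion of length at most the argument. The left
  inverse need not be definable by a term: the choice schema admits function parameters, so it
  enters as the value of a free variable.\<close>

primrec hier :: "nat \<Rightarrow> nat \<Rightarrow> nat" where
  "hier 0 = Suc"
| "hier (Suc k) = (\<lambda>x. (hier k ^^ (x + 2)) x)"

declare hier.simps(2) [simp del]

lemma funpow_add_le:
  fixes f :: "nat \<Rightarrow> nat"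
  assumes "\<And>x. x < f x"
  shows "x + n \<le> (f ^^ n) x"
proof (induction n)
  case (Suc n)
  then show ?case using assms[of "(f ^^ n) x"] by simp
qed simp

lemma funpow_le_funpow:
  fixes f :: "nat \<Rightarrow> nat"
  assumes "\<And>x. x < f x" "m \<le> n"
  shows "(f ^^ m) x \<le> (f ^^ n) x"
  using assms(2)
proof (induction n rule: dec_induct)
  case (step n)
  then show ?case using assms(1)[of "(f ^^ n) x"] by simp
qed simp

lemma hier_gt: "x < hier k x"
proof (induction k arbitrary: x)
  case (Suc k)
  have "x + (x + 2) \<le> (hier k ^^ (x + 2)) x"
    by (rule funpow_add_le) (rule Suc)
  then show ?case by (simp add: hier.simps(2))
qed simp

lemma hier_mono: "x \<le> y \<Longrightarrow> hier k x \<le> hier k y"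
proof (induction k arbitrary: x y)
  case (Suc k)
  have "mono (hier k)"
    using Suc.IH by (auto intro: monoI)
  then have "(hier k ^^ (x + 2)) x \<le> (hier k ^^ (x + 2)) y"
    using Suc.prems by (simp add: funpow_mono del: add_2_eq_Suc')
  also have "\<dots> \<le> (hier k ^^ (y + 2)) y"
    by (rule funpow_le_funpow) (use Suc.prems in \<open>auto simp: hier_gt\<close>)
  finally show ?case by (simp add: hier.simps(2))
qed simp

text \<open>The exponent \<open>x + 2\<close> in the hierarchy gives at least two iterations even at
  \<open>0\<close>, so one level absorbs a composition at every argument.\<close>

lemma hier_hier_le: "hier k (hier k x) \<le> hier (Suc k) x"
  using funpow_le_funpow[of "hier k" 2 "x + 2" x] by (simp add: hier.simps(2) hier_gt numeral_2_eq_2)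

lemma hier_lt_Suc: "hier k x < hier (Suc k) x"
  using hier_hier_le[of k x] hier_gt[of "hier k x" k] by (rule less_le_trans[rotated])

lemma hier_le_hier: "j \<le> k \<Longrightarrow> hier j x \<le> hier k x"
  by (rule lift_Suc_mono_le[where f = "\<lambda>k. hier k x"]) (auto intro: less_imp_le hier_lt_Suc)

lemma hier_mono2: "j \<le> k \<Longrightarrow> x \<le> y \<Longrightarrow> hier j x \<le> hier k y"
  using hier_le_hier hier_mono le_trans by blast

lemma hier_comp_le: "i \<le> k \<Longrightarrow> j \<le> k \<Longrightarrow> hier i (hier j x) \<le> hier (Suc k) x"
  by (rule order_trans[OF hier_mono2[OF _ hier_mono2] hier_hier_le]) auto

text \<open>Each level gains at least one over the preceding one. This later turns a number into a
  level, through \<open>max M n \<le> hier M n\<close>.\<close>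

lemma add_less_hier: "x + k < hier k x"
proof (induction k)
  case (Suc k)
  then show ?case using hier_lt_Suc[of k x] by linarith
qed simp

text \<open>Recursion costs one level. \<open>M\<close> bounds the parameters and the number of
  steps. The iterates of \<open>hier k\<close> at \<open>M\<close> stay above \<open>M\<close>, so
  the maximum in the step disappears; the next level offers \<open>M + 2\<close> iterations, enough
  for the \<open>N + 1\<close> that are used.\<close>

lemma iteration_bound:
  assumes "f 0 \<le> hier k M"
    and "\<And>n. n < N \<Longrightarrow> f (Suc n) \<le> hier k (max M (f n))"
    and "N \<le> M"
  shows "f N \<le> hier (Suc k) M"
proof -
  \<comment> \<open>The exponent is \<open>Suc n\<close> because the initial value already takes one
    application of \<open>hier k\<close>.\<close>
  have "n \<le> N \<Longrightarrow> f n \<le> (hier k ^^ Suc n) M" for n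
  proof (induction n)
    case (Suc n)
    have "M \<le> (hier k ^^ Suc n) M"
      using funpow_add_le[of "hier k" M "Suc n"] by (simp add: hier_gt del: funpow.simps)
    then have "max M (f n) \<le> (hier k ^^ Suc n) M"
      using Suc by simp
    then have "f (Suc n) \<le> hier k ((hier k ^^ Suc n) M)"
      using assms(2)[of n] Suc.prems hier_mono order_trans by (meson Suc_le_lessD)
    then show ?case by simp
  qed (use assms(1) in simp)
  then have "f N \<le> (hier k ^^ Suc N) M" by simp
  also have "\<dots> \<le> (hier k ^^ (M + 2)) M"
    by (rule funpow_le_funpow) (use assms(3) in \<open>auto simp: hier_gt\<close>)
  finally show ?thesis by (simp add: hier.simps(2))
qed

text \<open>\<open>hier 1 M\<close> is \<open>2 * M + 2\<close>.\<close>

lemma add_le_hier: "x \<le> M \<Longrightarrow> y \<le> M \<Longrightarrow> x + y \<le> hier 1 M"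
  using funpow_add_le[of "hier 0" M "M + 2"] by (simp add: hier.simps(2))

text \<open>A product is an iterated sum, hence one level above sums.\<close>

lemma mult_le_hier: "x \<le> M \<Longrightarrow> y \<le> M \<Longrightarrow> x * y \<le> hier 2 M"
  using iteration_bound[of "\<lambda>n. x * n" 1 M y] add_le_hier[of x "max M z" z for z]
  by (simp add: numeral_2_eq_2)

section \<open>Bounded functions, the diagonal function and its left inverse\<close>

definition bounded_fn :: "(nat \<Rightarrow> nat) \<Rightarrow> bool" where
  "bounded_fn f \<longleftrightarrow> (\<exists>k. \<forall>n. f n \<le> hier k n)"

text \<open>A relative of the Ackermann function. It escapes level \<open>k\<close> already at the
  argument \<open>Suc k\<close>.\<close>

definition diag :: "nat \<Rightarrow> nat" where
  "diag x = hier x x"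

lemma hier_lt_diag: "hier k (Suc k) < diag (Suc k)"
  unfolding diag_def by (rule hier_lt_Suc)

lemma strict_mono_diag: "strict_mono diag"
  unfolding strict_mono_Suc_iff
  using hier_lt_diag hier_mono[of n "Suc n" n for n] by (auto simp: diag_def intro: le_less_trans)

text \<open>The default \<open>0\<close> keeps the function below the identity and makes only the
  preimage of \<open>0\<close> ambiguous: a right inverse is still forced at every positive
  argument.\<close>

definition undiag :: "nat \<Rightarrow> nat" where
  "undiag y = (if y \<in> range diag then inv diag y else 0)"

lemma undiag_diag [simp]: "undiag (diag x) = x"
  using strict_mono_diag by (simp add: undiag_def strict_mono_imp_inj_on)

lemma undiag_eqD: "undiag y = Suc x \<Longrightarrow> y = diag (Suc x)"
  by (metis undiag_def f_inv_into_f nat.distinct(1))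

text \<open>A strictly increasing function on the naturals lies above the identity, so its inverse
  lies below it, and level \<open>0\<close> is enough.\<close>

lemma bounded_fn_undiag: "bounded_fn undiag"
proof -
  have "undiag y \<le> y" for y
    using strict_mono_diag f_inv_into_f[of y diag UNIV] strict_mono_imp_increasing[of diag "inv diag y"]
    by (auto simp: undiag_def)
  then have "undiag y \<le> hier 0 y" for y
    by (simp add: le_SucI)
  then show ?thesis unfolding bounded_fn_def by blast
qed

text \<open>A level \<open>k\<close> that bounds \<open>f\<close> is refuted at the single argument
  \<open>Suc k\<close>, where \<open>f\<close> has to take the value
  \<open>diag (Suc k)\<close>.\<close>

lemma no_bounded_right_inverse_undiag:
  assumes "\<And>x. undiag (f x) = x"
  shows "\<not> bounded_fn f"
proof
  assume "bounded_fn f"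
  then obtain k where "f n \<le> hier k n" for n
    unfolding bounded_fn_def by blast
  moreover have "f (Suc k) = diag (Suc k)"
    using undiag_eqD assms by blast
  ultimately show False
    using hier_lt_diag[of k] by (metis not_le)
qed

section \<open>Semantics\<close>

type_synonym 'c interp = "'c \<Rightarrow> nat list \<Rightarrow> (nat \<Rightarrow> nat) list \<Rightarrow> nat"

fun val :: "'c interp \<Rightarrow> (nat \<Rightarrow> nat) \<Rightarrow> (nat \<Rightarrow> nat \<Rightarrow> nat) \<Rightarrow> 'c tm \<Rightarrow> nat"
  and fval :: "'c interp \<Rightarrow> (nat \<Rightarrow> nat) \<Rightarrow> (nat \<Rightarrow> nat \<Rightarrow> nat) \<Rightarrow> 'c fn \<Rightarrow> nat \<Rightarrow> nat" where
  "val I e g (NVar x) = e x"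
| "val I e g Zero = 0"
| "val I e g (Con c ts us) = I c (map (val I e g) ts) (map (fval I e g) us)"
| "val I e g (App u t) = fval I e g u (val I e g t)"
| "fval I e g (FVar a) = g a"
| "fval I e g (FCon c) = (\<lambda>n. I c [n] [])"
| "fval I e g (Lam x t) = (\<lambda>n. val I (e(x := n)) g t)"

text \<open>Truth is classical, so the independence would survive the addition of excluded middle.
  Number quantifiers range over all standard numbers, which makes induction hold for every
  formula.\<close>

fun sat :: "'c interp \<Rightarrow> (nat \<Rightarrow> nat) \<Rightarrow> (nat \<Rightarrow> nat \<Rightarrow> nat) \<Rightarrow> 'c fm \<Rightarrow> bool" where
  "sat I e g (Eq s t) \<longleftrightarrow> val I e g s = val I e g t"
| "sat I e g (And A B) \<longleftrightarrow> sat I e g A \<and> sat I e g B"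
| "sat I e g (Or A B) \<longleftrightarrow> sat I e g A \<or> sat I e g B"
| "sat I e g (Imp A B) \<longleftrightarrow> (sat I e g A \<longrightarrow> sat I e g B)"
| "sat I e g (Not A) \<longleftrightarrow> \<not> sat I e g A"
| "sat I e g (AllN x A) \<longleftrightarrow> (\<forall>n. sat I (e(x := n)) g A)"
| "sat I e g (ExN x A) \<longleftrightarrow> (\<exists>n. sat I (e(x := n)) g A)"
| "sat I e g (AllF a A) \<longleftrightarrow> (\<forall>f. bounded_fn f \<longrightarrow> sat I e (g(a := f)) A)"
| "sat I e g (ExF a A) \<longleftrightarrow> (\<exists>f. bounded_fn f \<and> sat I e (g(a := f)) A)"

definition valid :: "'c interp \<Rightarrow> 'c fm \<Rightarrow> bool" where
  "valid I A \<longleftrightarrow> (\<forall>e g. (\<forall>a. bounded_fn (g a)) \<longrightarrow> sat I e g A)"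

section \<open>Coincidence and substitution lemmas\<close>

lemma val_cong:
  fixes t :: "'c tm" and u :: "'c fn"
  shows "(\<And>x. NV x \<in> fv_tm t \<Longrightarrow> e x = e' x) \<Longrightarrow> (\<And>a. FV a \<in> fv_tm t \<Longrightarrow> g a = g' a) \<Longrightarrow>
      val I e g t = val I e' g' t"
    and "(\<And>x. NV x \<in> fv_fn u \<Longrightarrow> e x = e' x) \<Longrightarrow> (\<And>a. FV a \<in> fv_fn u \<Longrightarrow> g a = g' a) \<Longrightarrow>
      fval I e g u = fval I e' g' u"
proof (induction t and u arbitrary: e e' and e e')
  case (Con c ts us)
  have "map (val I e g) ts = map (val I e' g') ts" "map (fval I e g) us = map (fval I e' g') us"
    using Con.prems by (auto intro!: Con.IH) blast+
  then show ?case by (simp del: map_eq_conv)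
next
  case (App u t)
  have "val I e g t = val I e' g' t" "fval I e g u = fval I e' g' u"
    using App by (auto intro!: App.IH)
  then show ?case by simp
next
  case (Lam x t)
  have "val I (e(x := n)) g t = val I (e'(x := n)) g' t" for n
    using Lam.prems by (intro Lam.IH) auto
  then show ?case by (simp del: fun_upd_apply)
qed auto

lemma sat_cong:
  "(\<And>x. NV x \<in> fv A \<Longrightarrow> e x = e' x) \<Longrightarrow> (\<And>a. FV a \<in> fv A \<Longrightarrow> g a = g' a) \<Longrightarrow>
    sat I e g A = sat I e' g' A"
proof (induction A arbitrary: e e' g g')
  case (Eq s t)
  then show ?case using val_cong(1)[of s e e' g g' I] val_cong(1)[of t e e' g g' I] by simp
next
  case (And A B)
  then show ?case by (metis UnCI fv.simps(2) sat.simps(2))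
next
  case (Or A B)
  then show ?case by (metis UnCI fv.simps(3) sat.simps(3))
next
  case (Imp A B)
  then show ?case by (metis UnCI fv.simps(4) sat.simps(4))
next
  case (Not A)
  then show ?case by (metis fv.simps(5) sat.simps(5))
next
  case (AllN x A)
  have "sat I (e(x := n)) g A = sat I (e'(x := n)) g' A" for n
    using AllN.prems by (intro AllN.IH) auto
  then show ?case by simp
next
  case (ExN x A)
  have "sat I (e(x := n)) g A = sat I (e'(x := n)) g' A" for n
    using ExN.prems by (intro ExN.IH) auto
  then show ?case by simp
next
  case (AllF a A)
  have "sat I e (g(a := f)) A = sat I e' (g'(a := f)) A" for f
    using AllF.prems by (intro AllF.IH) auto
  then show ?case by simp
next
  case (ExF a A)
  have "sat I e (g(a := f)) A = sat I e' (g'(a := f)) A" for f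
    using ExF.prems by (intro ExF.IH) auto
  then show ?case by simp
qed

lemma val_fun_upd_fresh:
  "NV x \<notin> fv_tm t \<Longrightarrow> val I (e(x := n)) g t = val I e g t"
  "NV x \<notin> fv_fn u \<Longrightarrow> fval I (e(x := n)) g u = fval I e g u"
  "FV a \<notin> fv_tm t \<Longrightarrow> val I e (g(a := f)) t = val I e g t"
  "FV a \<notin> fv_fn u \<Longrightarrow> fval I e (g(a := f)) u = fval I e g u"
  by (auto intro!: val_cong)

lemma sat_fun_upd_fresh:
  "NV x \<notin> fv A \<Longrightarrow> sat I (e(x := n)) g A = sat I e g A"
  "FV a \<notin> fv A \<Longrightarrow> sat I e (g(a := f)) A = sat I e g A"
  by (auto intro!: sat_cong)

text \<open>\<open>free_for\<close> says nothing about the scope of a binder in which the variable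
  is not free, so no induction hypothesis is available there. In the substitution lemmas that case
  is settled by the substitution being the identity.\<close>

lemma sbn_tm_fresh:
  "NV x \<notin> fv_tm t \<Longrightarrow> sbn_tm x s t = t"
  "NV x \<notin> fv_fn u \<Longrightarrow> sbn_fn x s u = u"
  by (induction t and u) (auto intro: map_idI)

lemma sbf_tm_fresh:
  "FV a \<notin> fv_tm t \<Longrightarrow> sbf_tm a v t = t"
  "FV a \<notin> fv_fn u \<Longrightarrow> sbf_fn a v u = u"
  by (induction t and u) (auto intro: map_idI)

lemma sbn_fresh: "NV x \<notin> fv A \<Longrightarrow> sbn x s A = A"
  by (induction A) (auto simp: sbn_tm_fresh)

lemma sbf_fresh: "FV a \<notin> fv A \<Longrightarrow> sbf a v A = A"
  by (induction A) (auto simp: sbf_tm_fresh)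

text \<open>Inside terms only \<open>Lam\<close> binds, and it binds number variables; hence only
  the number variables of \<open>s\<close> have to lie in \<open>V\<close>.\<close>

lemma val_sbn_tm:
  assumes "\<And>y. NV y \<in> fv_tm s \<Longrightarrow> NV y \<in> V"
  shows "free_for_tm (NV x) V t \<Longrightarrow> val I e g (sbn_tm x s t) = val I (e(x := val I e g s)) g t"
    and "free_for_fn (NV x) V u \<Longrightarrow> fval I e g (sbn_fn x s u) = fval I (e(x := val I e g s)) g u"
proof (induction t and u arbitrary: e and e)
  case (Con c ts us)
  then show ?case by (simp add: comp_def cong: map_cong)
next
  case (Lam y t)
  \<comment> \<open>The substituted variable is rebound, or does not occur freely, or occurs freely;
    only in the last case does \<open>free_for_fn\<close> exclude capture and feed the
    induction.\<close>
  consider "y = x" | "y \<noteq> x" "NV x \<notin> fv_tm t" | "y \<noteq> x" "NV x \<in> fv_tm t" by blast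
  then show ?case
  proof cases
    case 2
    then show ?thesis by (simp add: sbn_tm_fresh fun_upd_twist val_fun_upd_fresh del: fun_upd_apply)
  next
    case 3
    then have "NV y \<notin> fv_tm s" "free_for_tm (NV x) V t"
      using Lam.prems assms by auto
    then show ?thesis
      using 3 Lam.IH by (auto simp: val_fun_upd_fresh fun_upd_twist simp del: fun_upd_apply)
  qed (simp del: fun_upd_apply)
qed auto

lemma val_sbf_tm:
  assumes "\<And>y. NV y \<in> fv_fn v \<Longrightarrow> NV y \<in> V"
  shows "free_for_tm (FV a) V t \<Longrightarrow> val I e g (sbf_tm a v t) = val I e (g(a := fval I e g v)) t"
    and "free_for_fn (FV a) V u \<Longrightarrow> fval I e g (sbf_fn a v u) = fval I e (g(a := fval I e g v)) u"
proof (induction t and u arbitrary: e and e)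
  case (Con c ts us)
  then show ?case by (simp add: comp_def cong: map_cong)
next
  case (Lam y t)
  show ?case
  proof (cases "FV a \<in> fv_tm t")
    case False
    then show ?thesis by (simp add: sbf_tm_fresh val_fun_upd_fresh del: fun_upd_apply)
  next
    case True
    then have "NV y \<notin> fv_fn v" "free_for_tm (FV a) V t"
      using Lam.prems assms by auto
    then show ?thesis
      using Lam.IH by (auto simp: val_fun_upd_fresh simp del: fun_upd_apply)
  qed
qed auto

lemma sat_sbn:
  assumes "fv_tm s \<subseteq> V"
  shows "free_for (NV x) V A \<Longrightarrow> sat I e g (sbn x s A) = sat I (e(x := val I e g s)) g A"
proof (induction A arbitrary: e g)
  case (Eq t r)
  then show ?case using assms by (simp add: val_sbn_tm[of s V] subset_iff del: fun_upd_apply)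
next
  case (AllN y A)
  consider "y = x" | "y \<noteq> x" "NV x \<notin> fv A" | "y \<noteq> x" "NV x \<in> fv A" by blast
  then show ?case
  proof cases
    case 2
    then show ?thesis by (simp add: sbn_fresh fun_upd_twist sat_fun_upd_fresh del: fun_upd_apply)
  next
    case 3
    then have "NV y \<notin> fv_tm s" "free_for (NV x) V A"
      using AllN.prems assms by auto
    then show ?thesis
      using 3 AllN.IH by (auto simp: val_fun_upd_fresh fun_upd_twist simp del: fun_upd_apply)
  qed (simp del: fun_upd_apply)
next
  case (ExN y A)
  consider "y = x" | "y \<noteq> x" "NV x \<notin> fv A" | "y \<noteq> x" "NV x \<in> fv A" by blast
  then show ?case
  proof cases
    case 2
    then show ?thesis by (simp add: sbn_fresh fun_upd_twist sat_fun_upd_fresh del: fun_upd_apply)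
  next
    case 3
    then have "NV y \<notin> fv_tm s" "free_for (NV x) V A"
      using ExN.prems assms by auto
    then show ?thesis
      using 3 ExN.IH by (auto simp: val_fun_upd_fresh fun_upd_twist simp del: fun_upd_apply)
  qed (simp del: fun_upd_apply)
next
  case (AllF b A)
  show ?case
  proof (cases "NV x \<in> fv A")
    case False
    then show ?thesis by (simp add: sbn_fresh sat_fun_upd_fresh del: fun_upd_apply)
  next
    case True
    then have "FV b \<notin> fv_tm s" "free_for (NV x) V A"
      using AllF.prems assms by auto
    then show ?thesis
      using AllF.IH by (auto simp: val_fun_upd_fresh simp del: fun_upd_apply)
  qed
next
  case (ExF b A)
  show ?case
  proof (cases "NV x \<in> fv A")
    case False
    then show ?thesis by (simp add: sbn_fresh sat_fun_upd_fresh del: fun_upd_apply)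
  next
    case True
    then have "FV b \<notin> fv_tm s" "free_for (NV x) V A"
      using ExF.prems assms by auto
    then show ?thesis
      using ExF.IH by (auto simp: val_fun_upd_fresh simp del: fun_upd_apply)
  qed
qed auto

lemma sat_sbf:
  assumes "fv_fn v \<subseteq> V"
  shows "free_for (FV a) V A \<Longrightarrow> sat I e g (sbf a v A) = sat I e (g(a := fval I e g v)) A"
proof (induction A arbitrary: e g)
  case (Eq t r)
  then show ?case using assms by (simp add: val_sbf_tm[of v V] subset_iff del: fun_upd_apply)
next
  case (AllN y A)
  show ?case
  proof (cases "FV a \<in> fv A")
    case False
    then show ?thesis by (simp add: sbf_fresh sat_fun_upd_fresh del: fun_upd_apply)
  next
    case True
    then have "NV y \<notin> fv_fn v" "free_for (FV a) V A"
      using AllN.prems assms by auto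
    then show ?thesis
      using AllN.IH by (auto simp: val_fun_upd_fresh simp del: fun_upd_apply)
  qed
next
  case (ExN y A)
  show ?case
  proof (cases "FV a \<in> fv A")
    case False
    then show ?thesis by (simp add: sbf_fresh sat_fun_upd_fresh del: fun_upd_apply)
  next
    case True
    then have "NV y \<notin> fv_fn v" "free_for (FV a) V A"
      using ExN.prems assms by auto
    then show ?thesis
      using ExN.IH by (auto simp: val_fun_upd_fresh simp del: fun_upd_apply)
  qed
next
  case (AllF b A)
  consider "b = a" | "b \<noteq> a" "FV a \<notin> fv A" | "b \<noteq> a" "FV a \<in> fv A" by blast
  then show ?case
  proof cases
    case 2
    then show ?thesis by (simp add: sbf_fresh fun_upd_twist sat_fun_upd_fresh del: fun_upd_apply)
  next
    case 3
    then have "FV b \<notin> fv_fn v" "free_for (FV a) V A"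
      using AllF.prems assms by auto
    then show ?thesis
      using 3 AllF.IH by (auto simp: val_fun_upd_fresh fun_upd_twist simp del: fun_upd_apply)
  qed (simp del: fun_upd_apply)
next
  case (ExF b A)
  consider "b = a" | "b \<noteq> a" "FV a \<notin> fv A" | "b \<noteq> a" "FV a \<in> fv A" by blast
  then show ?case
  proof cases
    case 2
    then show ?thesis by (simp add: sbf_fresh fun_upd_twist sat_fun_upd_fresh del: fun_upd_apply)
  next
    case 3
    then have "FV b \<notin> fv_fn v" "free_for (FV a) V A"
      using ExF.prems assms by auto
    then show ?thesis
      using 3 ExF.IH by (auto simp: val_fun_upd_fresh fun_upd_twist simp del: fun_upd_apply)
  qed (simp del: fun_upd_apply)
qed auto

section \<open>Bounds on the values of terms\<close>

text \<open>
  The bound has to be uniform in the arguments, since a constant may be applied to functors with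
  number parameters and then be abstracted over those parameters.
\<close>

definition tame :: "nat \<times> nat \<Rightarrow> (nat list \<Rightarrow> (nat \<Rightarrow> nat) list \<Rightarrow> nat) \<Rightarrow> bool" where
  "tame kl F \<longleftrightarrow> (\<forall>j. \<exists>i. \<forall>ts us M. (length ts, length us) = kl \<longrightarrow> (\<forall>t\<in>set ts. t \<le> M) \<longrightarrow>
     (\<forall>u\<in>set us. \<forall>n. u n \<le> hier j (max M n)) \<longrightarrow> F ts us \<le> hier i M)"

definition tame_interp :: "'c arity \<Rightarrow> 'c interp \<Rightarrow> bool" where
  "tame_interp ar I \<longleftrightarrow> (\<forall>c kl. ar c = Some kl \<longrightarrow> tame kl (I c))"

text \<open>Restricted to a set of variables because an assignment to infinitely many variables need
  not have a common bound; for the finitely many variables of one expression there always is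
  one.\<close>

definition env_bound :: "nat \<Rightarrow> nat \<Rightarrow> var set \<Rightarrow> (nat \<Rightarrow> nat) \<Rightarrow> (nat \<Rightarrow> nat \<Rightarrow> nat) \<Rightarrow> bool" where
  "env_bound j M V e g \<longleftrightarrow> (\<forall>x. NV x \<in> V \<longrightarrow> e x \<le> M) \<and>
     (\<forall>a. FV a \<in> V \<longrightarrow> (\<forall>n. g a n \<le> hier j (max M n)))"

lemma env_bound_mono: "env_bound j M V e g \<Longrightarrow> W \<subseteq> V \<Longrightarrow> env_bound j M W e g"
  unfolding env_bound_def by blast

lemma ex_uniform_bound:
  assumes "\<And>x. x \<in> set xs \<Longrightarrow> \<exists>k. P x k" "\<And>x k l. P x k \<Longrightarrow> k \<le> l \<Longrightarrow> P x l"
  shows "\<exists>k::nat. \<forall>x\<in>set xs. P x k"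
  using assms(1)
proof (induction xs)
  case (Cons x xs)
  have "\<exists>k. \<forall>x\<in>set xs. P x k"
    by (rule Cons.IH) (simp add: Cons.prems)
  moreover have "\<exists>l. P x l"
    by (simp add: Cons.prems)
  ultimately obtain k l where "\<forall>x\<in>set xs. P x k" "P x l"
    by blast
  then show ?case
    using assms(2) by (intro exI[of _ "max k l"]) auto
qed simp

text \<open>The level \<open>k\<close> depends on the expression and on \<open>j\<close>, and is
  chosen before the assignment and \<open>M\<close>. So in the case of \<open>Lam\<close> the value
  \<open>n\<close> of the bound variable can be moved into the bound, from \<open>M\<close> to
  \<open>max M n\<close>, at the same level; application and constants pay for a
  composition.\<close>

lemma val_bound:
  assumes "tame_interp ar I"
  shows "wf_tm ar t \<Longrightarrow> \<exists>k. \<forall>e g M. env_bound j M (fv_tm t) e g \<longrightarrow> val I e g t \<le> hier k M"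
    and "wf_fn ar u \<Longrightarrow> \<exists>k. \<forall>e g M. env_bound j M (fv_fn u) e g \<longrightarrow>
      (\<forall>n. fval I e g u n \<le> hier k (max M n))"
proof (induction t and u)
  case (NVar x)
  show ?case
    by (rule exI[of _ 0]) (auto simp: env_bound_def le_SucI)
next
  case (Con c ts us)
  let ?P = "\<lambda>t k. \<forall>e g M. env_bound j M (fv_tm t) e g \<longrightarrow> val I e g t \<le> hier k M"
  let ?Q = "\<lambda>u k. \<forall>e g M. env_bound j M (fv_fn u) e g \<longrightarrow>
    (\<forall>n. fval I e g u n \<le> hier k (max M n))"
  have "\<exists>k. \<forall>t\<in>set ts. ?P t k"
  proof (rule ex_uniform_bound)
    show "?P t l" if "?P t k" "k \<le> l" for t k l
      using that hier_le_hier le_trans by blast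
  qed (use Con in auto)
  moreover have "\<exists>k. \<forall>u\<in>set us. ?Q u k"
  proof (rule ex_uniform_bound)
    show "?Q u l" if "?Q u k" "k \<le> l" for u k l
      using that hier_le_hier le_trans by blast
  qed (use Con in auto)
  ultimately obtain k l where k: "\<forall>t\<in>set ts. ?P t k" and l: "\<forall>u\<in>set us. ?Q u l"
    by blast
  have "tame (length ts, length us) (I c)"
    using assms Con.prems unfolding tame_interp_def by simp
  then obtain i where i: "length ts' = length ts \<Longrightarrow> length us' = length us \<Longrightarrow> \<forall>t\<in>set ts'. t \<le> M \<Longrightarrow>
      \<forall>u\<in>set us'. \<forall>n. u n \<le> hier l (max M n) \<Longrightarrow> I c ts' us' \<le> hier i M" for ts' us' M
    unfolding tame_def by fastforce
  \<comment> \<open>The bound \<open>hier k M\<close> on the number arguments takes the role of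
    \<open>M\<close> in the tameness of the constant. The bounds on the functors survive this
    change, since levels are monotone.\<close>
  have "val I e g (Con c ts us) \<le> hier (Suc (max i k)) M"
    if eb: "env_bound j M (fv_tm (Con c ts us)) e g" for e g M
  proof -
    have "val I e g t \<le> hier k M" if "t \<in> set ts" for t
    proof -
      have "env_bound j M (fv_tm t) e g"
        by (rule env_bound_mono[OF eb]) (use that in auto)
      then show ?thesis using k that by blast
    qed
    moreover have "fval I e g u n \<le> hier l (max (hier k M) n)" if "u \<in> set us" for u n
    proof -
      have "env_bound j M (fv_fn u) e g"
        by (rule env_bound_mono[OF eb]) (use that in auto)
      then have "fval I e g u n \<le> hier l (max M n)"
        using l that by blast
      also have "\<dots> \<le> hier l (max (hier k M) n)"
        using hier_gt[of M k] by (intro hier_mono) auto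
      finally show ?thesis .
    qed
    ultimately have "val I e g (Con c ts us) \<le> hier i (hier k M)"
      by (simp add: i)
    also have "\<dots> \<le> hier (Suc (max i k)) M"
      by (rule hier_comp_le) auto
    finally show ?thesis .
  qed
  then show ?case by blast
next
  case (App u t)
  then have wf: "wf_fn ar u" "wf_tm ar t" by auto
  obtain k where
    k: "\<And>e g M. env_bound j M (fv_tm t) e g \<Longrightarrow> val I e g t \<le> hier k M"
    using App.IH(2)[OF wf(2)] by blast
  obtain l where
    l: "\<And>e g M n. env_bound j M (fv_fn u) e g \<Longrightarrow> fval I e g u n \<le> hier l (max M n)"
    using App.IH(1)[OF wf(1)] by blast
  have "val I e g (App u t) \<le> hier (Suc (max l k)) M"
    if eb: "env_bound j M (fv_tm (App u t)) e g" for e g M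
  proof -
    have "fval I e g u (val I e g t) \<le> hier l (max M (val I e g t))"
      by (rule l, rule env_bound_mono[OF eb]) simp
    also have "\<dots> \<le> hier l (hier k M)"
      using hier_gt[of M k] k[OF env_bound_mono[OF eb, of "fv_tm t"]] by (intro hier_mono) auto
    also have "\<dots> \<le> hier (Suc (max l k)) M"
      by (rule hier_comp_le) auto
    finally show ?thesis by simp
  qed
  then show ?case by blast
next
  case (FVar a)
  show ?case
    by (rule exI[of _ j]) (simp add: env_bound_def)
next
  case (FCon c)
  then have "tame (1, 0) (I c)"
    using assms unfolding tame_interp_def by simp
  then obtain i where "length ts = 1 \<Longrightarrow> \<forall>t\<in>set ts. t \<le> M \<Longrightarrow> I c ts [] \<le> hier i M" for ts M
    unfolding tame_def by force
  then have "I c [n] [] \<le> hier i (max M n)" for M n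
    by simp
  then show ?case by auto
next
  case (Lam x t)
  then obtain k where
    k: "\<And>e g M. env_bound j M (fv_tm t) e g \<Longrightarrow> val I e g t \<le> hier k M"
    by auto
  have "val I (e(x := n)) g t \<le> hier k (max M n)" if eb: "env_bound j M (fv_fn (Lam x t)) e g" for e g M n
  proof -
    have "g a m \<le> hier j (max (max M n) m)" if "FV a \<in> fv_tm t" for a m
    proof -
      have "FV a \<in> fv_fn (Lam x t)"
        using that by simp
      then have "g a m \<le> hier j (max M m)"
        using eb unfolding env_bound_def by blast
      also have "\<dots> \<le> hier j (max (max M n) m)"
        by (rule hier_mono) auto
      finally show ?thesis .
    qed
    moreover have "(e(x := n)) y \<le> max M n" if "NV y \<in> fv_tm t" for y
    proof (cases "y = x")
      case False
      then have "NV y \<in> fv_fn (Lam x t)"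
        using that by simp
      then have "e y \<le> M"
        using eb unfolding env_bound_def by blast
      then show ?thesis using False by simp
    qed simp
    ultimately have "env_bound j (max M n) (fv_tm t) (e(x := n)) g"
      unfolding env_bound_def by blast
    then show ?thesis by (rule k)
  qed
  then show ?case
    unfolding fv_fn.simps fval.simps by blast
qed auto

lemma finite_fv_tm:
  fixes t :: "'c tm" and u :: "'c fn"
  shows "finite (fv_tm t)" "finite (fv_fn u)"
  by (induction t and u) auto

text \<open>This places the values of functors in the range of the function quantifiers, as
  instantiating such a quantifier requires. The finitely many parameters have one common level
  \<open>j\<close> and one common bound \<open>M\<close>.\<close>

lemma bounded_fn_fval:
  assumes "tame_interp ar I" "wf_fn ar u" "\<And>a. bounded_fn (g a)"
  shows "bounded_fn (fval I e g u)"
proof -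
  obtain vs where vs: "set vs = fv_fn u"
    using finite_fv_tm(2) finite_list by blast
  have "\<exists>j. \<forall>v\<in>set vs. \<forall>a. v = FV a \<longrightarrow> (\<forall>n. g a n \<le> hier j n)"
  proof (rule ex_uniform_bound)
    show "\<exists>k. \<forall>a. v = FV a \<longrightarrow> (\<forall>n. g a n \<le> hier k n)" for v
    proof (cases v)
      case (FV a)
      then show ?thesis using assms(3)[of a] unfolding bounded_fn_def by auto
    qed simp
    show "\<forall>a. v = FV a \<longrightarrow> (\<forall>n. g a n \<le> hier l n)"
      if "\<forall>a. v = FV a \<longrightarrow> (\<forall>n. g a n \<le> hier k n)" "k \<le> l" for v k l
      using that(1) order_trans[OF _ hier_le_hier[OF that(2)]] by blast
  qed
  then obtain j where "\<forall>v\<in>fv_fn u. \<forall>a. v = FV a \<longrightarrow> (\<forall>n. g a n \<le> hier j n)"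
    unfolding vs ..
  then have j: "g a n \<le> hier j n" if "FV a \<in> fv_fn u" for a n
    using that by simp
  have "\<exists>M. \<forall>v\<in>set vs. \<forall>x. v = NV x \<longrightarrow> e x \<le> M"
  proof (rule ex_uniform_bound)
    show "\<exists>k. \<forall>x. v = NV x \<longrightarrow> e x \<le> k" for v
      by (cases v) auto
    show "\<forall>x. v = NV x \<longrightarrow> e x \<le> l"
      if "\<forall>x. v = NV x \<longrightarrow> e x \<le> k" "k \<le> l" for v k l
      using that(1) order_trans[OF _ that(2)] by blast
  qed
  then obtain M where "\<forall>v\<in>fv_fn u. \<forall>x. v = NV x \<longrightarrow> e x \<le> M"
    unfolding vs ..
  then have M: "e x \<le> M" if "NV x \<in> fv_fn u" for x
    using that by simp
  obtain k where k: "\<And>e g M n. env_bound j M (fv_fn u) e g \<Longrightarrow> fval I e g u n \<le> hier k (max M n)"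
    using val_bound(2)[OF assms(1,2), of j] by blast
  have "g a n \<le> hier j (max M n)" if "FV a \<in> fv_fn u" for a n
    using j[OF that] hier_mono[of n "max M n" j] by (meson max.cobounded2 order_trans)
  then have "env_bound j M (fv_fn u) e g"
    unfolding env_bound_def using M by blast
  note k = k[OF this]
  have "fval I e g u n \<le> hier (Suc (max k M)) n" for n
  proof -
    have "fval I e g u n \<le> hier k (max M n)"
      by (rule k)
    \<comment> \<open>The number \<open>M\<close> is traded for the level \<open>M\<close>, and the
      composition for one level more.\<close>
    also have "\<dots> \<le> hier k (hier M n)"
      using add_less_hier[of n M] by (intro hier_mono) simp
    also have "\<dots> \<le> hier (Suc (max k M)) n"
      by (rule hier_comp_le) auto
    finally show ?thesis .
  qed
  then show ?thesis
    unfolding bounded_fn_def by blast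
qed

section \<open>Soundness\<close>

text \<open>Only the two instantiation rules for function quantifiers need tameness. Axioms have to
  be valid only when well-formed; the equations for descriptions without an arity are thereby set
  aside.\<close>

lemma valid_if_proves:
  assumes "proves ar Ax A" "tame_interp ar I" "\<And>A. A \<in> Ax \<Longrightarrow> wf_fm ar A \<Longrightarrow> valid I A"
  shows "valid I A"
  using assms(1)
proof (induction rule: proves.induct)
  case (allN_i C A x)
  have "sat I e g (Imp C (AllN x A))" if "\<forall>a. bounded_fn (g a)" for e g
    using allN_i that sat_fun_upd_fresh(1)[of x C I e] by (auto simp: valid_def)
  then show ?case by (simp add: valid_def)
next
  case (exN_e A C x)
  have "sat I e g C" if "\<forall>a. bounded_fn (g a)" "sat I (e(x := n)) g A" for e g n
  proof -
    have "sat I (e(x := n)) g (Imp A C)"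
      using exN_e that unfolding valid_def by blast
    then show ?thesis
      using that exN_e sat_fun_upd_fresh(1)[of x C I e] by auto
  qed
  then show ?case by (auto simp: valid_def)
next
  case (allF_i C A a)
  have "sat I e (g(a := f)) A" if "\<forall>a. bounded_fn (g a)" "sat I e g C" "bounded_fn f" for e g f
  proof -
    have "sat I e (g(a := f)) (Imp C A)"
      using allF_i that unfolding valid_def by auto
    then show ?thesis
      using that allF_i sat_fun_upd_fresh(2)[of a C I e] by auto
  qed
  then show ?case by (simp add: valid_def)
next
  case (exF_e A C a)
  have "sat I e g C" if "\<forall>a. bounded_fn (g a)" "sat I e (g(a := f)) A" "bounded_fn f" for e g f
  proof -
    have "sat I e (g(a := f)) (Imp A C)"
      using exF_e that unfolding valid_def by auto
    then show ?thesis
      using that exF_e sat_fun_upd_fresh(2)[of a C I e] by auto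
  qed
  then show ?case by (auto simp: valid_def)
next
  case (allN_e A t x)
  then show ?case by (simp add: valid_def sat_sbn[OF order_refl])
next
  case (exN_i A t x)
  then show ?case by (auto simp: valid_def sat_sbn[OF order_refl])
next
  case (allF_e A u a)
  then show ?case
    using bounded_fn_fval[OF assms(2)] by (simp add: valid_def sat_sbf[OF order_refl])
next
  case (exF_i A u a)
  then show ?case
    using bounded_fn_fval[OF assms(2)] by (auto simp: valid_def sat_sbf[OF order_refl])
qed (use assms(3) in \<open>auto simp: valid_def\<close>)

text \<open>
  The instance of the axiom of choice that fails says that the function variable 1, here standing
  for \<open>undiag\<close>, has a right inverse if it is onto.
\<close>

lemma not_proves_QF_AC00:
  fixes ar :: "'c arity"
  assumes "tame_interp ar I" "\<And>A. A \<in> Ax \<Longrightarrow> wf_fm ar A \<Longrightarrow> valid I A"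
  shows "\<not> (\<forall>A\<in>QF_AC00 ar. proves ar Ax A)"
proof
  assume *: "\<forall>A\<in>QF_AC00 ar. proves ar Ax A"
  let ?A = "Eq (App (FVar 1) (NVar 1)) (NVar 0) :: 'c fm"
  let ?C = "Imp (AllN 0 (ExN 1 ?A)) (ExF 0 (AllN 0 (sbn 1 (App (FVar 0) (NVar 0)) ?A)))"
  have "wf_fm ar ?A \<and> quantifier_free ?A \<and> (0::nat) \<noteq> 1 \<and> FV 0 \<notin> fv ?A \<and>
      free_for (NV 1) {NV 0, FV 0} ?A"
    by simp
  then have "?C \<in> QF_AC00 ar"
    unfolding QF_AC00_def by blast
  then have "valid I ?C"
    using * valid_if_proves[OF _ assms] by blast
  \<comment> \<open>Function variable 1 is the only free variable of \<open>?C\<close>, so every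
    function variable may be given the value \<open>undiag\<close>.\<close>
  then have "sat I (\<lambda>_. 0) (\<lambda>_. undiag) ?C"
    unfolding valid_def by (elim allE impE) (auto intro: bounded_fn_undiag)
  then have "(\<forall>x. \<exists>y. undiag y = x) \<longrightarrow> (\<exists>f. bounded_fn f \<and> (\<forall>x. undiag (f x) = x))"
    by simp
  moreover have "\<forall>x. \<exists>y. undiag y = x"
    using undiag_diag by blast
  ultimately show False
    using no_bounded_right_inverse_undiag by blast
qed

section \<open>Validity of the schemata common to both systems\<close>

lemma free_for_tm_self:
  fixes t :: "'c tm" and u :: "'c fn"
  shows "free_for_tm (NV x) {NV x} t" "free_for_fn (NV x) {NV x} u"
  by (induction t and u) auto

text \<open>A binder for \<open>x\<close> leaves no free \<open>x\<close> in its scope, so a term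
  whose only variable is \<open>x\<close> cannot be captured when put for \<open>x\<close>. This is
  why the induction schema needs no \<open>free_for\<close> condition for its successor
  step.\<close>

lemma free_for_self: "free_for (NV x) {NV x} A"
  by (induction A) (auto simp: free_for_tm_self)

lemma free_for_tm_empty:
  fixes t :: "'c tm" and u :: "'c fn"
  shows "free_for_tm v {} t" "free_for_fn v {} u"
  by (induction t and u) auto

lemma free_for_empty: "free_for v {} A"
  by (induction A) (auto simp: free_for_tm_empty)

lemma valid_induction_schema:
  assumes "A \<in> induction_schema S" "fv_fn S = {}" "\<And>e g. fval I e g S = Suc"
  shows "valid I A"
proof -
  obtain x B where A: "A = Imp (And (sbn x Zero B) (AllN x (Imp B (sbn x (App S (NVar x)) B)))) B"
    using assms(1) unfolding induction_schema_def by blast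
  have "sat I (e(x := n)) g B"
    if "sat I e g (sbn x Zero B)" "sat I e g (AllN x (Imp B (sbn x (App S (NVar x)) B)))" for e g n
  proof (induction n)
    case 0
    then show ?case using that(1) by (simp add: sat_sbn[OF _ free_for_empty] del: fun_upd_apply)
  next
    case (Suc n)
    then show ?case
      using that(2) assms(2,3) by (simp add: sat_sbn[OF _ free_for_self] fun_upd_same del: fun_upd_apply)
  qed
  \<comment> \<open>The conclusion of the schema is open in \<open>x\<close>; it is the instance at
    the value that \<open>e\<close> gives to \<open>x\<close>.\<close>
  from this[where n = "e x" and e = e for e] show ?thesis
    by (auto simp: A valid_def)
qed

lemma valid_lambda_conversion: "A \<in> lambda_conversion \<Longrightarrow> valid I A"
  by (auto simp: lambda_conversion_def valid_def val_sbn_tm(1)[where V = "fv_tm s" and s = s for s])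

lemma val_capp:
  assumes "ar c = Some (length ts, length us)"
  shows "val I e g (capp ar c ts us) = I c (map (val I e g) ts) (map (fval I e g) us)"
  using assms by (auto simp: capp_def length_Suc_conv)

lemma wf_tm_capp: "wf_tm ar (capp ar c ts us) \<Longrightarrow> ar c \<noteq> None"
  by (auto simp: capp_def split: if_splits)

section \<open>Closure properties of tame functionals\<close>

lemma tameD:
  assumes "tame (k, l) F"
  obtains i where "\<And>ts us M. \<lbrakk>length ts = k; length us = l; \<And>t. t \<in> set ts \<Longrightarrow> t \<le> M;
    \<And>u n. u \<in> set us \<Longrightarrow> u n \<le> hier j (max M n)\<rbrakk> \<Longrightarrow> F ts us \<le> hier i M"
  using assms unfolding tame_def by (metis (no_types, lifting))

lemma tameI:
  assumes "\<And>j. \<exists>i. \<forall>ts us M. length ts = k \<longrightarrow> length us = l \<longrightarrow> (\<forall>t\<in>set ts. t \<le> M) \<longrightarrow>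
     (\<forall>u\<in>set us. \<forall>n. u n \<le> hier j (max M n)) \<longrightarrow> F ts us \<le> hier i M"
  shows "tame (k, l) F"
  unfolding tame_def Pair_inject using assms by blast

lemma tameI_uniform:
  assumes "\<And>ts us M. length ts = k \<Longrightarrow> length us = l \<Longrightarrow> (\<And>t. t \<in> set ts \<Longrightarrow> t \<le> M) \<Longrightarrow> F ts us \<le> hier i M"
  shows "tame (k, l) F"
  by (rule tameI, rule exI[of _ i]) (use assms in blast)

text \<open>Rearranged arguments have no new values, so the same level works. It serves to move the
  previous value of a recursion from the second place to the last.\<close>

lemma tame_reindex:
  assumes "tame (k, l) F"
    and "\<And>ts. length ts = k' \<Longrightarrow> length (h ts) = k"
    and "\<And>ts. length ts = k' \<Longrightarrow> set (h ts) \<subseteq> set ts"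
  shows "tame (k', l) (\<lambda>ts us. F (h ts) us)"
proof (rule tameI)
  fix j
  obtain i where i: "\<And>ts us M. \<lbrakk>length ts = k; length us = l; \<And>t. t \<in> set ts \<Longrightarrow> t \<le> M;
    \<And>u n. u \<in> set us \<Longrightarrow> u n \<le> hier j (max M n)\<rbrakk> \<Longrightarrow> F ts us \<le> hier i M"
    by (rule tameD[OF assms(1)]) blast
  have "F (h ts) us \<le> hier i M" if "length ts = k'" "length us = l" "\<forall>t\<in>set ts. t \<le> M"
    "\<forall>u\<in>set us. \<forall>n. u n \<le> hier j (max M n)" for ts us M
    by (rule i) (use that assms(2)[of ts] assms(3)[of ts] in blast)+
  then show "\<exists>i. \<forall>ts us M. length ts = k' \<longrightarrow> length us = l \<longrightarrow> (\<forall>t\<in>set ts. t \<le> M) \<longrightarrow>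
     (\<forall>u\<in>set us. \<forall>n. u n \<le> hier j (max M n)) \<longrightarrow> F (h ts) us \<le> hier i M"
    by blast
qed

text \<open>The number of steps is itself an argument, hence at most \<open>M\<close>. The previous
  value may exceed \<open>M\<close>, so the step is estimated at the maximum of the two, as
  \<open>iteration_bound\<close> expects.\<close>

lemma tame_rec_nat:
  assumes "tame (k, l) F" "tame (Suc (Suc k), l) G"
  shows "tame (Suc k, l) (\<lambda>ts us. rec_nat (F (tl ts) us) (\<lambda>y r. G (y # r # tl ts) us) (hd ts))"
proof (rule tameI)
  fix j
  obtain a where a: "\<And>ts us M. \<lbrakk>length ts = k; length us = l; \<And>t. t \<in> set ts \<Longrightarrow> t \<le> M;
    \<And>u n. u \<in> set us \<Longrightarrow> u n \<le> hier j (max M n)\<rbrakk> \<Longrightarrow> F ts us \<le> hier a M"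
    by (rule tameD[OF assms(1)]) blast
  obtain b where b: "\<And>ts us M. \<lbrakk>length ts = Suc (Suc k); length us = l; \<And>t. t \<in> set ts \<Longrightarrow> t \<le> M;
    \<And>u n. u \<in> set us \<Longrightarrow> u n \<le> hier j (max M n)\<rbrakk> \<Longrightarrow> G ts us \<le> hier b M"
    by (rule tameD[OF assms(2)]) blast
  have "rec_nat (F (tl ts) us) (\<lambda>y r. G (y # r # tl ts) us) (hd ts) \<le> hier (Suc (max a b)) M"
    if len: "length ts = Suc k" "length us = l" and ts: "\<forall>t\<in>set ts. t \<le> M"
      and us: "\<forall>u\<in>set us. \<forall>n. u n \<le> hier j (max M n)" for ts us M
  proof (rule iteration_bound[where f = "rec_nat (F (tl ts) us) (\<lambda>y r. G (y # r # tl ts) us)"])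
    obtain N xs where [simp]: "ts = N # xs" and "length xs = k"
      using len by (cases ts) auto
    show "hd ts \<le> M" using ts by simp
    have "F xs us \<le> hier a M"
      by (rule a) (use ts us len in auto)
    also have "\<dots> \<le> hier (max a b) M"
      by (rule hier_le_hier) simp
    finally show "rec_nat (F (tl ts) us) (\<lambda>y r. G (y # r # tl ts) us) 0 \<le> hier (max a b) M"
      by simp
    fix n
    let ?r = "rec_nat (F (tl ts) us) (\<lambda>y r. G (y # r # tl ts) us) n"
    assume "n < hd ts"
    then have "n \<le> M" using ts by simp
    have "G (n # ?r # xs) us \<le> hier b (max M ?r)"
    proof (rule b)
      show "t \<le> max M ?r" if "t \<in> set (n # ?r # xs)" for t
        using that ts \<open>n \<le> M\<close> by (auto intro: max.coboundedI1)
      show "u m \<le> hier j (max (max M ?r) m)" if "u \<in> set us" for u m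
      proof -
        have "u m \<le> hier j (max M m)"
          using us that by blast
        also have "\<dots> \<le> hier j (max (max M ?r) m)"
          by (rule hier_mono) simp
        finally show ?thesis .
      qed
    qed (use len \<open>length xs = k\<close> in auto)
    also have "\<dots> \<le> hier (max a b) (max M ?r)"
      by (rule hier_le_hier) simp
    finally show "rec_nat (F (tl ts) us) (\<lambda>y r. G (y # r # tl ts) us) (Suc n) \<le> hier (max a b) (max M ?r)"
      by simp
  qed
  then show "\<exists>i. \<forall>ts us M. length ts = Suc k \<longrightarrow> length us = l \<longrightarrow> (\<forall>t\<in>set ts. t \<le> M) \<longrightarrow>
     (\<forall>u\<in>set us. \<forall>n. u n \<le> hier j (max M n)) \<longrightarrow>
     rec_nat (F (tl ts) us) (\<lambda>y r. G (y # r # tl ts) us) (hd ts) \<le> hier i M"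
    by blast
qed

text \<open>An open term gives a tame functional of its variables. The assignments only have to pick
  members of the argument lists, so parameters may be numbered from 0 or from 1.\<close>

lemma tame_val:
  assumes "tame_interp ar I" "wf_tm ar p"
    and "\<And>ts x. length ts = k \<Longrightarrow> NV x \<in> fv_tm p \<Longrightarrow> e ts x \<in> set ts"
    and "\<And>us a. length us = l \<Longrightarrow> FV a \<in> fv_tm p \<Longrightarrow> g us a \<in> set us"
  shows "tame (k, l) (\<lambda>ts us. val I (e ts) (g us) p)"
proof (rule tameI)
  fix j
  obtain i where i: "\<And>e g M. env_bound j M (fv_tm p) e g \<Longrightarrow> val I e g p \<le> hier i M"
    using val_bound(1)[OF assms(1,2), of j] by blast
  have "val I (e ts) (g us) p \<le> hier i M"
    if "length ts = k" "length us = l" "\<forall>t\<in>set ts. t \<le> M"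
      "\<forall>u\<in>set us. \<forall>n. u n \<le> hier j (max M n)" for ts us M
  proof (rule i)
    show "env_bound j M (fv_tm p) (e ts) (g us)"
      unfolding env_bound_def using that assms(3)[OF that(1)] assms(4)[OF that(2)] by blast
  qed
  then show "\<exists>i. \<forall>ts us M. length ts = k \<longrightarrow> length us = l \<longrightarrow> (\<forall>t\<in>set ts. t \<le> M) \<longrightarrow>
     (\<forall>u\<in>set us. \<forall>n. u n \<le> hier j (max M n)) \<longrightarrow> val I (e ts) (g us) p \<le> hier i M"
    by blast
qed

section \<open>The model of $\mathbf{HA_1}$\<close>

fun pev :: "prd \<Rightarrow> nat list \<Rightarrow> nat" where
  "pev (PZero n) ts = 0"
| "pev PSuc ts = Suc (hd ts)"
| "pev (PProj n i) ts = ts ! i"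
| "pev (PComp n h gs) ts = pev h (map (\<lambda>g. pev g ts) gs)"
| "pev (PRec f g) ts = rec_nat (pev f (tl ts)) (\<lambda>y r. pev g (y # r # tl ts)) (hd ts)"

text \<open>The classical domination of all primitive recursive functions by a fast-growing
  hierarchy: composition and recursion each raise the level by one above the levels of their
  parts.\<close>

lemma tame_pev: "prd_arity d = Some n \<Longrightarrow> tame (n, l) (\<lambda>ts us. pev d ts)"
proof (induction d arbitrary: n)
  case (PZero m)
  show ?case by (rule tameI_uniform) simp
next
  case PSuc
  show ?case
  proof (rule tameI_uniform[where i = 0])
    fix ts :: "nat list" and M
    assume "length ts = n" "\<And>t. t \<in> set ts \<Longrightarrow> t \<le> M"
    then show "pev PSuc ts \<le> hier 0 M"
      using PSuc by (cases ts) auto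
  qed
next
  case (PProj m i)
  show ?case
  proof (rule tameI_uniform[where i = 0])
    fix ts :: "nat list" and M
    assume "length ts = n" "\<And>t. t \<in> set ts \<Longrightarrow> t \<le> M"
    then show "pev (PProj m i) ts \<le> hier 0 M"
      using PProj by (auto split: if_splits intro: le_SucI)
  qed
next
  case (PComp m h gs)
  then have n: "m = n" "prd_arity h = Some (length gs)" "\<And>g. g \<in> set gs \<Longrightarrow> prd_arity g = Some n"
    by (auto split: if_splits)
  show ?case
  proof (rule tameI)
    fix j
    obtain i where i: "\<And>ts us M. \<lbrakk>length ts = length gs; length us = l; \<And>t. t \<in> set ts \<Longrightarrow> t \<le> M;
      \<And>u n. u \<in> set us \<Longrightarrow> u n \<le> hier j (max M n)\<rbrakk> \<Longrightarrow> pev h ts \<le> hier i M"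
      by (rule tameD[OF PComp.IH(1)[OF n(2)]]) blast
    let ?P = "\<lambda>g i. \<forall>ts us M. length ts = n \<longrightarrow> length us = l \<longrightarrow> (\<forall>t\<in>set ts. t \<le> M) \<longrightarrow>
      (\<forall>u\<in>set us. \<forall>n. u n \<le> hier j (max M n)) \<longrightarrow> pev g ts \<le> hier i M"
    have "\<exists>i. \<forall>g\<in>set gs. ?P g i"
    proof (rule ex_uniform_bound)
      show "\<exists>i. ?P g i" if "g \<in> set gs" for g
        using PComp.IH(2)[OF that n(3)[OF that]] unfolding tame_def Pair_inject by blast
      show "?P g b" if "?P g a" "a \<le> b" for g a b
        using that(1) order_trans[OF _ hier_le_hier[OF that(2)]] by blast
    qed
    then obtain k where k: "\<forall>g\<in>set gs. ?P g k" ..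
    have "pev (PComp m h gs) ts \<le> hier (Suc (max i k)) M"
      if len: "length ts = n" "length us = l" and ts: "\<forall>t\<in>set ts. t \<le> M"
        and us: "\<forall>u\<in>set us. \<forall>n. u n \<le> hier j (max M n)" for ts and us :: "(nat \<Rightarrow> nat) list" and M
    proof -
      have "pev h (map (\<lambda>g. pev g ts) gs) \<le> hier i (hier k M)"
      proof (rule i)
        show "t \<le> hier k M" if t: "t \<in> set (map (\<lambda>g. pev g ts) gs)" for t
        proof -
          obtain g where "g \<in> set gs" "t = pev g ts"
            using t by auto
          then show ?thesis using k len ts us by blast
        qed
        show "u n \<le> hier j (max (hier k M) n)" if "u \<in> set us" for u n
        proof -
          have "u n \<le> hier j (max M n)"
            using us that by blast
          also have "\<dots> \<le> hier j (max (hier k M) n)"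
            using hier_gt[of M k] by (intro hier_mono) simp
          finally show ?thesis .
        qed
      qed (use len in auto)
      also have "\<dots> \<le> hier (Suc (max i k)) M"
        by (rule hier_comp_le) auto
      finally show ?thesis by simp
    qed
    then show "\<exists>i. \<forall>ts us M. length ts = n \<longrightarrow> length us = l \<longrightarrow> (\<forall>t\<in>set ts. t \<le> M) \<longrightarrow>
      (\<forall>u\<in>set us. \<forall>n. u n \<le> hier j (max M n)) \<longrightarrow> pev (PComp m h gs) ts \<le> hier i M"
      by blast
  qed
next
  case (PRec f g)
  then obtain m where m: "prd_arity f = Some m" "prd_arity g = Some (Suc (Suc m))" "n = Suc m"
    by (auto split: option.splits if_splits)
  show ?case
    using tame_rec_nat[OF PRec.IH(1)[OF m(1)] PRec.IH(2)[OF m(2)]] m(3) by simp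
qed

text \<open>The pairing as a single description, so that \<open>tame_pev\<close> bounds it.
  \<open>prd_exp\<close> takes the exponent first; the bases 2 and 3 are constant functions of two
  arguments.\<close>

definition prd_pair :: prd where
  "prd_pair = PComp 2 prd_mul
     [PComp 2 prd_exp [PProj 2 0, PComp 2 PSuc [PComp 2 PSuc [PZero 2]]],
      PComp 2 prd_exp [PProj 2 1, PComp 2 PSuc [PComp 2 PSuc [PComp 2 PSuc [PZero 2]]]]]"

lemma prd_arity_add_mul_exp [simp]:
  "prd_arity prd_add = Some 2" "prd_arity prd_mul = Some 2" "prd_arity prd_exp = Some 2"
  by (simp_all add: prd_add_def prd_mul_def prd_exp_def)

lemma prd_arity_pair: "prd_arity prd_pair = Some 2"
  by (simp add: prd_pair_def)

fun ha_interp :: "ha_const interp" where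
  "ha_interp (Prim d) ts us = pev d ts"
| "ha_interp RecC ts us = rec_nat (ts ! 0) (\<lambda>n r. (us ! 0) (pev prd_pair [r, n])) (ts ! 1)"

text \<open>A recursion whose step is the function argument after pairing. The step is a composition
  of levels \<open>j\<close> and \<open>p\<close>, and the iteration costs one level more; the
  result depends on \<open>j\<close>, but not on the function itself.\<close>

lemma tame_ha_rec: "tame (2, 1) (ha_interp RecC)"
proof (rule tameI)
  fix j
  obtain p where p: "\<And>ts us M. \<lbrakk>length ts = 2; length us = 0; \<And>t. t \<in> set ts \<Longrightarrow> t \<le> M;
    \<And>u n. u \<in> set us \<Longrightarrow> u n \<le> hier j (max M n)\<rbrakk> \<Longrightarrow> pev prd_pair ts \<le> hier p M"
    by (rule tameD[OF tame_pev[OF prd_arity_pair, of 0]]) blast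
  have "ha_interp RecC ts us \<le> hier (Suc (Suc (max j p))) M"
    if len: "length ts = 2" "length us = 1" and ts: "\<forall>t\<in>set ts. t \<le> M"
      and us: "\<forall>u\<in>set us. \<forall>n. u n \<le> hier j (max M n)" for ts us M
    unfolding ha_interp.simps
  proof (rule iteration_bound[where f = "rec_nat (ts ! 0) (\<lambda>n r. (us ! 0) (pev prd_pair [r, n]))"])
    show "ts ! 1 \<le> M" using ts len by simp
    show "rec_nat (ts ! 0) (\<lambda>n r. (us ! 0) (pev prd_pair [r, n])) 0 \<le> hier (Suc (max j p)) M"
      using hier_gt[of M "Suc (max j p)"] ts len by (auto intro: le_trans[of _ M] less_imp_le)
    fix n
    let ?r = "rec_nat (ts ! 0) (\<lambda>n r. (us ! 0) (pev prd_pair [r, n])) n"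
    let ?q = "pev prd_pair [?r, n]"
    assume "n < ts ! 1"
    then have "n \<le> M" using \<open>ts ! 1 \<le> M\<close> by simp
    have q: "?q \<le> hier p (max M ?r)"
      by (rule p[of _ "[]"]) (use \<open>n \<le> M\<close> in auto)
    have "(us ! 0) ?q \<le> hier j (max M ?q)"
      using us len by simp
    also have "\<dots> \<le> hier j (hier p (max M ?r))"
      using q hier_gt[of "max M ?r" p] by (intro hier_mono) simp
    also have "\<dots> \<le> hier (Suc (max j p)) (max M ?r)"
      by (rule hier_comp_le) auto
    finally show "rec_nat (ts ! 0) (\<lambda>n r. (us ! 0) (pev prd_pair [r, n])) (Suc n)
        \<le> hier (Suc (max j p)) (max M ?r)"
      by simp
  qed
  then show "\<exists>i. \<forall>ts us M. length ts = 2 \<longrightarrow> length us = 1 \<longrightarrow> (\<forall>t\<in>set ts. t \<le> M) \<longrightarrow>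
     (\<forall>u\<in>set us. \<forall>n. u n \<le> hier j (max M n)) \<longrightarrow> ha_interp RecC ts us \<le> hier i M"
    by blast
qed

lemma tame_ha_interp: "tame_interp ha_arity ha_interp"
  unfolding tame_interp_def
proof (intro allI impI)
  fix c kl
  assume c: "ha_arity c = Some kl"
  show "tame kl (ha_interp c)"
  proof (cases c)
    case (Prim d)
    moreover have "ha_interp (Prim d) = (\<lambda>ts us. pev d ts)"
      by (simp add: fun_eq_iff)
    ultimately show ?thesis
      using c tame_pev by auto
  next
    case RecC
    then show ?thesis using c tame_ha_rec by simp
  qed
qed

section \<open>Values of description terms and validity of the axioms\<close>

lemma val_papp:
  "prd_arity d = Some (length ts) \<Longrightarrow>
    val ha_interp e g (papp d ts) = pev d (map (val ha_interp e g) ts)"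
  by (subst val_capp) auto

lemma wf_tm_papp: "wf_tm ha_arity (papp d ts) \<Longrightarrow> \<exists>n. prd_arity d = Some n"
  using wf_tm_capp[of ha_arity "Prim d"] by fastforce

lemma val_ha_pair:
  "val ha_interp e g (ha_pair a b) = pev prd_pair [val ha_interp e g a, val ha_interp e g b]"
  by (simp add: ha_pair_def prd_pair_def val_papp)

text \<open>Well-formedness of the equation gives the description an arity, and with it the arities
  of its parts. These ensure that the argument lists have the lengths at which \<open>pev\<close>
  computes the intended values.\<close>

lemma valid_prd_eqs:
  assumes "A \<in> prd_eqs d" "wf_fm ha_arity A"
  shows "valid ha_interp A"
proof (cases d)
  case (PZero n)
  then show ?thesis using assms by (simp add: valid_def val_papp)
next
  case (PProj n i)
  then have A: "A = Eq (papp (PProj n i) (map NVar [0..<n])) (NVar i)"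
    using assms by simp
  have "\<exists>m. prd_arity (PProj n i) = Some m"
    by (rule wf_tm_papp) (use A assms(2) in simp)
  then have "i < n"
    by (auto split: if_splits)
  then show ?thesis by (simp add: A valid_def val_papp)
next
  case (PComp n h gs)
  then have A: "A = Eq (papp (PComp n h gs) (map NVar [0..<n])) (papp h (map (\<lambda>g. papp g (map NVar [0..<n])) gs))"
    using assms by (simp add: Let_def)
  have "\<exists>m. prd_arity (PComp n h gs) = Some m"
    by (rule wf_tm_papp[where ts = "map NVar [0..<n]"]) (use A assms(2) in simp)
  then have "prd_arity h = Some (length gs)" "\<forall>g\<in>set gs. prd_arity g = Some n"
    by (auto split: if_splits)
  then show ?thesis by (simp add: A valid_def val_papp comp_def cong: map_cong)
next
  case (PRec f g)
  let ?xs = "map NVar [1..<Suc (the (prd_arity f))]"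
  have A: "A = Eq (papp (PRec f g) (Zero # ?xs)) (papp f ?xs) \<or>
     A = Eq (papp (PRec f g) (ha_suc (NVar 0) # ?xs)) (papp g (NVar 0 # papp (PRec f g) (NVar 0 # ?xs) # ?xs))"
    using assms PRec by (simp add: Let_def)
  then obtain ts where "wf_tm ha_arity (papp (PRec f g) ts)"
    using assms(2) by (metis wf_fm.simps(1))
  then have "\<exists>m. prd_arity (PRec f g) = Some m"
    by (rule wf_tm_papp)
  then obtain n where "prd_arity f = Some n" "prd_arity g = Some (Suc (Suc n))"
    by (auto split: if_splits option.splits)
  then show ?thesis using A by (auto simp: valid_def val_papp simp del: upt_Suc)
qed (use assms in simp)

lemma valid_HA1_axioms:
  assumes "A \<in> HA1_axioms" "wf_fm ha_arity A"
  shows "valid ha_interp A"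
proof -
  have "valid ha_interp (Imp (And B (Eq (NVar x) (NVar y))) (sbn x (NVar y) B))"
    if "free_for (NV x) {NV y} B" for x y B
  proof -
    have "e(x := e y) = e" if "e x = e y" for e :: "nat \<Rightarrow> nat"
      using that by (metis fun_upd_triv)
    then show ?thesis
      using that by (simp add: valid_def sat_sbn[of _ "{NV y}"] del: fun_upd_apply)
  qed
  moreover have "valid ha_interp B" if "B \<in> induction_schema (FCon (Prim PSuc))" for B
    by (rule valid_induction_schema[OF that]) auto
  moreover have "valid ha_interp (Eq (NVar x) (NVar x))"
    "valid ha_interp (Not (Eq (ha_suc Zero) Zero))"
    "valid ha_interp (Eq (ha_rec t u Zero) t)"
    "valid ha_interp (Eq (ha_rec t u (ha_suc s)) (App u (ha_pair (ha_rec t u s) s)))" for x t u s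
    by (simp_all add: valid_def val_ha_pair)
  ultimately show ?thesis
    using assms(1) valid_prd_eqs[OF _ assms(2)] valid_lambda_conversion[of A]
    unfolding HA1_axioms_def by blast
qed

section \<open>The model of $\mathbf{IA_1}$\<close>

definition sg :: "nat \<Rightarrow> nat" where
  "sg x = (if x = 0 then 0 else 1)"

definition sgbar :: "nat \<Rightarrow> nat" where
  "sgbar x = (if x = 0 then 1 else 0)"

definition distance :: "nat \<Rightarrow> nat \<Rightarrow> nat" where
  "distance a b = (a - b) + (b - a)"

text \<open>The value of the bounded least number operator \<open>ia_mu\<close>. In this form it
  agrees with that term by computation, and as each summand is at most 1, the bound \<open>b\<close>
  is immediate.\<close>

definition bounded_mu :: "(nat \<Rightarrow> nat) \<Rightarrow> nat \<Rightarrow> nat" where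
  "bounded_mu f b = (\<Sum>t<b. \<Prod>y<Suc t. sg (f y))"

definition factorial :: "nat \<Rightarrow> nat" where
  "factorial n = (\<Prod>i<n. Suc i)"

text \<open>
  Copied from the defining equation, so that nothing has to be known about primes; likewise for
  the functions that depend on it.
\<close>

primrec prime_enum :: "nat \<Rightarrow> nat" where
  "prime_enum 0 = 2"
| "prime_enum (Suc i) =
    bounded_mu (\<lambda>b. (Suc (prime_enum i) - b) + distance (\<Sum>c<b. sgbar (b mod Suc c)) 2)
      (factorial (prime_enum i) + 2)"

definition expt :: "nat \<Rightarrow> nat \<Rightarrow> nat" where
  "expt a i = bounded_mu (\<lambda>y. a mod prime_enum i ^ y + sgbar (a mod prime_enum i ^ Suc y)) a"

definition lh :: "nat \<Rightarrow> nat" where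
  "lh a = (\<Sum>i<a. sg (expt a i))"

text \<open>The value of \<open>CcpC\<close> is a parameter because it is computed from values of
  terms without \<open>CcpC\<close>, for which the rest of the interpretation has to be
  available.\<close>

fun ia_interp :: "(nat list \<Rightarrow> (nat \<Rightarrow> nat) list \<Rightarrow> nat) \<Rightarrow> ia_const interp" where
  "ia_interp F SucC ts us = Suc (ts ! 0)"
| "ia_interp F PlusC ts us = ts ! 0 + ts ! 1"
| "ia_interp F TimesC ts us = ts ! 0 * ts ! 1"
| "ia_interp F ExpC ts us = ts ! 0 ^ (ts ! 1)"
| "ia_interp F FactC ts us = factorial (ts ! 0)"
| "ia_interp F PredC ts us = ts ! 0 - 1"
| "ia_interp F MonusC ts us = ts ! 0 - ts ! 1"
| "ia_interp F Min2C ts us = min (ts ! 0) (ts ! 1)"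
| "ia_interp F Max2C ts us = max (ts ! 0) (ts ! 1)"
| "ia_interp F SgC ts us = sg (ts ! 0)"
| "ia_interp F SgBarC ts us = sgbar (ts ! 0)"
| "ia_interp F DistC ts us = distance (ts ! 0) (ts ! 1)"
| "ia_interp F RmC ts us = ts ! 0 mod ts ! 1"
| "ia_interp F QuotC ts us = ts ! 0 div ts ! 1"
| "ia_interp F SumC ts us = (\<Sum>y<ts ! 0. (us ! 0) y)"
| "ia_interp F ProdC ts us = (\<Prod>y<ts ! 0. (us ! 0) y)"
| "ia_interp F MinC ts us = Min ((us ! 0) ` {..ts ! 0})"
| "ia_interp F MaxC ts us = Max ((us ! 0) ` {..ts ! 0})"
| "ia_interp F PrimeC ts us = prime_enum (ts ! 0)"
| "ia_interp F ExptC ts us = expt (ts ! 0) (ts ! 1)"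
| "ia_interp F LhC ts us = lh (ts ! 0)"
| "ia_interp F CatC ts us =
    ts ! 0 * (\<Prod>i<lh (ts ! 1). prime_enum (lh (ts ! 0) + i) ^ expt (ts ! 1) i)"
| "ia_interp F BarC ts us = (\<Prod>i<ts ! 0. prime_enum i ^ Suc ((us ! 0) i))"
| "ia_interp F TildeC ts us = (\<Prod>i<ts ! 0. prime_enum i ^ (us ! 0) i)"
| "ia_interp F CircC ts us =
    (\<Prod>i<max (ts ! 0) (ts ! 1). prime_enum i ^ max (expt (ts ! 0) i) (expt (ts ! 1) i))"
| "ia_interp F CcpC ts us = F ts us"

section \<open>Growth of the functions and functionals\<close>

lemma sg_le: "sg x \<le> Suc 0"
  by (simp add: sg_def)

lemma bounded_mu_le: "bounded_mu f b \<le> b"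
proof -
  have "(\<Prod>y<Suc t. sg (f y)) \<le> 1" for t
    by (rule prod_le_1) (simp add: sg_le)
  then have "(\<Sum>t<b. \<Prod>y<Suc t. sg (f y)) \<le> (\<Sum>t<b. 1)"
    by (intro sum_mono)
  then show ?thesis by (simp add: bounded_mu_def)
qed

lemma expt_le: "expt a i \<le> a"
  unfolding expt_def by (rule bounded_mu_le)

lemma lh_le: "lh a \<le> a"
  using sum_mono[of "{..<a}" "\<lambda>i. sg (expt a i)" "\<lambda>_. 1"] by (simp add: lh_def sg_le)

lemma power_le_hier:
  assumes "x \<le> M" "y \<le> M"
  shows "x ^ y \<le> hier 3 M"
proof -
  have "x ^ y \<le> hier (Suc 2) M"
  proof (rule iteration_bound[where f = "\<lambda>n. x ^ n"])
    show "x ^ 0 \<le> hier 2 M"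
      using add_less_hier[of M 2] by simp
    show "x ^ Suc n \<le> hier 2 (max M (x ^ n))" for n
      using mult_le_hier[of x "max M (x ^ n)" "x ^ n"] assms(1) by simp
  qed fact
  then show ?thesis by (simp add: numeral_3_eq_3 numeral_2_eq_2)
qed

lemma factorial_le_hier: "factorial n \<le> hier 3 n"
proof -
  have "factorial n \<le> hier (Suc 2) n"
  proof (rule iteration_bound[where f = factorial])
    show "factorial 0 \<le> hier 2 n"
      using add_less_hier[of n 2] by (simp add: factorial_def)
    show "factorial (Suc m) \<le> hier 2 (max n (factorial m))" if "m < n" for m
      using mult_le_hier[of "factorial m" "max n (factorial m)" "Suc m"] that
      by (simp add: factorial_def)
  qed simp
  then show ?thesis by (simp add: numeral_3_eq_3 numeral_2_eq_2)
qed

text \<open>A bounded search never exceeds its bound, here a factorial plus 2. Levels 3 and 2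
  compose to level 4 for one step, and the iteration gives level 5; primality does not
  enter.\<close>

lemma prime_enum_le_hier: "prime_enum i \<le> hier 5 i"
proof -
  have "prime_enum i \<le> hier (Suc 4) i"
  proof (rule iteration_bound[where f = prime_enum])
    show "prime_enum 0 \<le> hier 4 i"
      using add_less_hier[of i 4] by simp
    fix n
    have "prime_enum (Suc n) \<le> factorial (prime_enum n) + 2"
      unfolding prime_enum.simps by (rule bounded_mu_le)
    also have "\<dots> \<le> hier 2 (factorial (prime_enum n))"
      using add_less_hier less_imp_le by blast
    also have "\<dots> \<le> hier 2 (hier 3 (prime_enum n))"
      by (rule hier_mono) (rule factorial_le_hier)
    also have "\<dots> \<le> hier (Suc 3) (prime_enum n)"
      by (rule hier_comp_le) auto
    also have "\<dots> \<le> hier 4 (max i (prime_enum n))"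
      by (rule hier_mono2) auto
    finally show "prime_enum (Suc n) \<le> hier 4 (max i (prime_enum n))" .
  qed simp
  then show ?thesis by simp
qed

text \<open>The function is evaluated only below \<open>M\<close>, where \<open>max M n\<close> is
  \<open>M\<close>, so the sum is at most \<open>M\<close> times \<open>hier j M\<close>. For the
  bounded product a power takes the place of this product.\<close>

lemma tame_ia_sum: "tame (1, 1) (ia_interp F SumC)"
proof (rule tameI)
  fix j
  have "ia_interp F SumC ts us \<le> hier (Suc (max 2 j)) M"
    if len: "length ts = 1" "length us = 1" and ts: "\<forall>t\<in>set ts. t \<le> M"
      and us: "\<forall>u\<in>set us. \<forall>n. u n \<le> hier j (max M n)" for ts us M
  proof -
    have b: "ts ! 0 \<le> M" and u: "(us ! 0) n \<le> hier j (max M n)" for n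
      using ts us len by auto
    have "(us ! 0) n \<le> hier j M" if "n < ts ! 0" for n
      using u[of n] b that by (simp add: max_absorb1)
    then have "(\<Sum>y<ts ! 0. (us ! 0) y) \<le> (\<Sum>y<ts ! 0. hier j M)"
      by (intro sum_mono) simp
    also have "\<dots> = ts ! 0 * hier j M"
      by simp
    also have "\<dots> \<le> hier 2 (hier j M)"
      using b hier_gt[of M j] by (intro mult_le_hier) auto
    also have "\<dots> \<le> hier (Suc (max 2 j)) M"
      by (rule hier_comp_le) auto
    finally show ?thesis by simp
  qed
  then show "\<exists>i. \<forall>ts us M. length ts = 1 \<longrightarrow> length us = 1 \<longrightarrow> (\<forall>t\<in>set ts. t \<le> M) \<longrightarrow>
     (\<forall>u\<in>set us. \<forall>n. u n \<le> hier j (max M n)) \<longrightarrow> ia_interp F SumC ts us \<le> hier i M"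
    by blast
qed

lemma tame_ia_prod: "tame (1, 1) (ia_interp F ProdC)"
proof (rule tameI)
  fix j
  have "ia_interp F ProdC ts us \<le> hier (Suc (max 3 j)) M"
    if len: "length ts = 1" "length us = 1" and ts: "\<forall>t\<in>set ts. t \<le> M"
      and us: "\<forall>u\<in>set us. \<forall>n. u n \<le> hier j (max M n)" for ts us M
  proof -
    have b: "ts ! 0 \<le> M" and u: "(us ! 0) n \<le> hier j (max M n)" for n
      using ts us len by auto
    have "(us ! 0) n \<le> hier j M" if "n < ts ! 0" for n
      using u[of n] b that by (simp add: max_absorb1)
    then have "(\<Prod>y<ts ! 0. (us ! 0) y) \<le> (\<Prod>y<ts ! 0. hier j M)"
      by (intro prod_mono) simp
    also have "\<dots> = hier j M ^ (ts ! 0)"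
      by simp
    also have "\<dots> \<le> hier 3 (hier j M)"
      using b hier_gt[of M j] by (intro power_le_hier) auto
    also have "\<dots> \<le> hier (Suc (max 3 j)) M"
      by (rule hier_comp_le) auto
    finally show ?thesis by simp
  qed
  then show "\<exists>i. \<forall>ts us M. length ts = 1 \<longrightarrow> length us = 1 \<longrightarrow> (\<forall>t\<in>set ts. t \<le> M) \<longrightarrow>
     (\<forall>u\<in>set us. \<forall>n. u n \<le> hier j (max M n)) \<longrightarrow> ia_interp F ProdC ts us \<le> hier i M"
    by blast
qed

text \<open>Both functionals select a member of a finite nonempty set of values at arguments up to
  \<open>M\<close>, so level \<open>j\<close> suffices.\<close>

lemma tame_ia_Min_Max: "tame (1, 1) (ia_interp F MinC)" "tame (1, 1) (ia_interp F MaxC)"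
proof -
  have *: "tame (1, 1) (\<lambda>ts us. G ((us ! 0) ` {..ts ! 0}))"
    if G: "\<And>S. finite S \<Longrightarrow> S \<noteq> {} \<Longrightarrow> G S \<in> S" for G :: "nat set \<Rightarrow> nat"
  proof (rule tameI)
    fix j
    have "G ((us ! 0) ` {..ts ! 0}) \<le> hier j M"
      if len: "length ts = 1" "length us = 1" and ts: "\<forall>t\<in>set ts. t \<le> M"
        and us: "\<forall>u\<in>set us. \<forall>n. u n \<le> hier j (max M n)" for ts us M
    proof -
      have b: "ts ! 0 \<le> M" and u: "(us ! 0) n \<le> hier j (max M n)" for n
        using ts us len by auto
      have "G ((us ! 0) ` {..ts ! 0}) \<in> (us ! 0) ` {..ts ! 0}"
        by (rule G) auto
      then obtain n where "G ((us ! 0) ` {..ts ! 0}) = (us ! 0) n" "n \<le> ts ! 0"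
        by auto
      then show ?thesis
        using u[of n] b by (simp add: max_absorb1)
    qed
    then show "\<exists>i. \<forall>ts us M. length ts = 1 \<longrightarrow> length us = 1 \<longrightarrow> (\<forall>t\<in>set ts. t \<le> M) \<longrightarrow>
       (\<forall>u\<in>set us. \<forall>n. u n \<le> hier j (max M n)) \<longrightarrow> G ((us ! 0) ` {..ts ! 0}) \<le> hier i M"
      by blast
  qed
  have eqs: "ia_interp F MinC = (\<lambda>ts us. Min ((us ! 0) ` {..ts ! 0}))"
    "ia_interp F MaxC = (\<lambda>ts us. Max ((us ! 0) ` {..ts ! 0}))"
    by (simp_all add: fun_eq_iff)
  show "tame (1, 1) (ia_interp F MinC)"
    unfolding eqs by (rule *[where G = Min]) (rule Min_in)
  show "tame (1, 1) (ia_interp F MaxC)"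
    unfolding eqs by (rule *[where G = Max]) (rule Max_in)
qed

text \<open>A sublanguage whose constants are estimated one by one. The constants left out by name
  are explicit terms over it and inherit their bounds from \<open>val_bound\<close>.\<close>

definition ia_arity_basic :: "ia_const arity" where
  "ia_arity_basic c = (if c \<in> {CatC, BarC, TildeC, CircC} then None else ia_arity None c)"

lemma tame_interp_ia_basic: "tame_interp ia_arity_basic (ia_interp F)"
proof -
  have le1: "tame (k, l) G"
    if "\<And>ts us M. length ts = k \<Longrightarrow> (\<And>t. t \<in> set ts \<Longrightarrow> t \<le> M) \<Longrightarrow> G ts us \<le> Suc M"
    for k l G
    by (rule tameI_uniform[where i = 0]) (use that in simp)
  have unary: "tame (1, 0) G" if "\<And>t us. G [t] us \<le> Suc t" for G
  proof (rule le1)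
    fix ts :: "nat list" and us M
    assume "length ts = 1" "\<And>t. t \<in> set ts \<Longrightarrow> t \<le> M"
    then obtain t where "ts = [t]" "t \<le> M" by (cases ts) auto
    then show "G ts us \<le> Suc M"
      using that[of t us] by simp
  qed
  have binary: "tame (2, 0) G" if "\<And>s t M us. s \<le> M \<Longrightarrow> t \<le> M \<Longrightarrow> G [s, t] us \<le> hier i M" for G i
  proof (rule tameI_uniform)
    fix ts :: "nat list" and us M
    assume len: "length ts = 2" and M: "\<And>t. t \<in> set ts \<Longrightarrow> t \<le> M"
    obtain s t where ts: "ts = [s, t]"
      using len by (auto simp: length_Suc_conv numeral_2_eq_2)
    show "G ts us \<le> hier i M"
      using that[of s M t us] M unfolding ts by simp
  qed
  have hier1: "tame (1, 0) G" if "\<And>t us. G [t] us \<le> hier i t" for G i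
  proof (rule tameI_uniform)
    fix ts :: "nat list" and us M
    assume "length ts = 1" "\<And>t. t \<in> set ts \<Longrightarrow> t \<le> M"
    then obtain t where "ts = [t]" "t \<le> M" by (cases ts) auto
    then show "G ts us \<le> hier i M"
      using that[of t us] hier_mono[of t M i] by simp
  qed
  have "tame kl (ia_interp F c)" if "ia_arity_basic c = Some kl" for c kl
  proof (cases c)
    case PlusC
    have "tame (2, 0) (ia_interp F PlusC)"
      by (rule binary[where i = 1]) (use add_le_hier in simp)
    then show ?thesis using that PlusC by (simp add: ia_arity_basic_def)
  next
    case TimesC
    have "tame (2, 0) (ia_interp F TimesC)"
      by (rule binary[where i = 2]) (use mult_le_hier in simp)
    then show ?thesis using that TimesC by (simp add: ia_arity_basic_def)
  next
    case ExpC
    have "tame (2, 0) (ia_interp F ExpC)"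
      by (rule binary[where i = 3]) (use power_le_hier in simp)
    then show ?thesis using that ExpC by (simp add: ia_arity_basic_def)
  next
    case FactC
    have "tame (1, 0) (ia_interp F FactC)"
      by (rule hier1[where i = 3]) (use factorial_le_hier in simp)
    then show ?thesis using that FactC by (simp add: ia_arity_basic_def)
  next
    case PrimeC
    have "tame (1, 0) (ia_interp F PrimeC)"
      by (rule hier1[where i = 5]) (use prime_enum_le_hier in simp)
    then show ?thesis using that PrimeC by (simp add: ia_arity_basic_def)
  next
    case SucC
    have "tame (1, 0) (ia_interp F SucC)" by (rule unary) simp
    then show ?thesis using that SucC by (simp add: ia_arity_basic_def)
  next
    case PredC
    have "tame (1, 0) (ia_interp F PredC)" by (rule unary) simp
    then show ?thesis using that PredC by (simp add: ia_arity_basic_def)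
  next
    case SgC
    have "tame (1, 0) (ia_interp F SgC)" by (rule unary) (simp add: sg_def)
    then show ?thesis using that SgC by (simp add: ia_arity_basic_def)
  next
    case SgBarC
    have "tame (1, 0) (ia_interp F SgBarC)" by (rule unary) (simp add: sgbar_def)
    then show ?thesis using that SgBarC by (simp add: ia_arity_basic_def)
  next
    case LhC
    have "tame (1, 0) (ia_interp F LhC)" by (rule unary) (simp add: le_SucI lh_le)
    then show ?thesis using that LhC by (simp add: ia_arity_basic_def)
  next
    case MonusC
    have "tame (2, 0) (ia_interp F MonusC)" by (rule binary[where i = 0]) simp
    then show ?thesis using that MonusC by (simp add: ia_arity_basic_def)
  next
    case Min2C
    have "tame (2, 0) (ia_interp F Min2C)" by (rule binary[where i = 0]) simp
    then show ?thesis using that Min2C by (simp add: ia_arity_basic_def)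
  next
    case Max2C
    have "tame (2, 0) (ia_interp F Max2C)" by (rule binary[where i = 0]) simp
    then show ?thesis using that Max2C by (simp add: ia_arity_basic_def)
  next
    case DistC
    have "tame (2, 0) (ia_interp F DistC)" by (rule binary[where i = 0]) (simp add: distance_def)
    then show ?thesis using that DistC by (simp add: ia_arity_basic_def)
  next
    case RmC
    have "tame (2, 0) (ia_interp F RmC)"
      by (rule binary[where i = 0]) (simp add: le_SucI le_trans[OF mod_less_eq_dividend])
    then show ?thesis using that RmC by (simp add: ia_arity_basic_def)
  next
    case QuotC
    have "tame (2, 0) (ia_interp F QuotC)"
      by (rule binary[where i = 0]) (simp add: le_SucI le_trans[OF div_le_dividend])
    then show ?thesis using that QuotC by (simp add: ia_arity_basic_def)
  next
    case ExptC
    have "tame (2, 0) (ia_interp F ExptC)"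
      by (rule binary[where i = 0]) (simp add: le_SucI le_trans[OF expt_le])
    then show ?thesis using that ExptC by (simp add: ia_arity_basic_def)
  qed (use that tame_ia_sum tame_ia_prod tame_ia_Min_Max in \<open>simp_all add: ia_arity_basic_def\<close>)
  then show ?thesis
    unfolding tame_interp_def by blast
qed

lemma tame_ia_explicit:
  assumes "wf_tm ia_arity_basic p"
    and "fv_tm p \<subseteq> NV ` {..<k} \<union> FV ` {..<l}"
    and "\<And>ts us. G ts us = val (ia_interp F) ((!) ts) ((!) us) p"
  shows "tame (k, l) G"
proof -
  have "tame (k, l) (\<lambda>ts us. val (ia_interp F) ((!) ts) ((!) us) p)"
    by (rule tame_val[OF tame_interp_ia_basic assms(1)]) (use assms(2) in auto)
  then show ?thesis
    unfolding assms(3)[symmetric] .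
qed

text \<open>The terms are the right sides of the defining equations, with parameters of each sort
  numbered from 0.\<close>

lemma tame_interp_ia: "tame_interp (ia_arity None) (ia_interp F)"
proof -
  have cat: "tame (2, 0) (ia_interp F CatC)"
    by (rule tame_ia_explicit[where F = F and p = "ia_times (NVar 0)
          (ia_bd ProdC (ia_ap1 LhC (NVar 1))
            (Lam 2 (ia_ap2 ExpC (ia_ap1 PrimeC (ia_plus (ia_ap1 LhC (NVar 0)) (NVar 2)))
              (ia_ap2 ExptC (NVar 1) (NVar 2)))))"])
      (auto simp: ia_arity_basic_def)
  have bar: "tame (1, 1) (ia_interp F BarC)"
    by (rule tame_ia_explicit[where F = F and p = "ia_bd ProdC (NVar 0)
          (Lam 2 (ia_ap2 ExpC (ia_ap1 PrimeC (NVar 2)) (ia_suc (App (FVar 0) (NVar 2)))))"])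
      (auto simp: ia_arity_basic_def)
  have tilde: "tame (1, 1) (ia_interp F TildeC)"
    by (rule tame_ia_explicit[where F = F and p = "ia_bd ProdC (NVar 0)
          (Lam 2 (ia_ap2 ExpC (ia_ap1 PrimeC (NVar 2)) (App (FVar 0) (NVar 2))))"])
      (auto simp: ia_arity_basic_def)
  have circ: "tame (2, 0) (ia_interp F CircC)"
    by (rule tame_ia_explicit[where F = F and p = "ia_bd ProdC (ia_ap2 Max2C (NVar 0) (NVar 1))
          (Lam 2 (ia_ap2 ExpC (ia_ap1 PrimeC (NVar 2))
            (ia_ap2 Max2C (ia_ap2 ExptC (NVar 0) (NVar 2)) (ia_ap2 ExptC (NVar 1) (NVar 2)))))"])
      (auto simp: ia_arity_basic_def)
  have "tame kl (ia_interp F c)" if "ia_arity None c = Some kl" for c kl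
  proof (cases "c \<in> {CatC, BarC, TildeC, CircC}")
    case True
    then show ?thesis using that cat bar tilde circ by auto
  next
    case False
    then have "ia_arity_basic c = Some kl"
      using that by (simp add: ia_arity_basic_def)
    then show ?thesis
      using tame_interp_ia_basic unfolding tame_interp_def by blast
  qed
  then show ?thesis
    unfolding tame_interp_def by blast
qed

section \<open>The constant introduced by an admissible definition\<close>

lemma val_interp_cong:
  fixes t :: "'c tm" and u :: "'c fn"
  assumes "\<And>c. ar c \<noteq> None \<Longrightarrow> I c = I' c"
  shows "wf_tm ar t \<Longrightarrow> val I e g t = val I' e g t"
    and "wf_fn ar u \<Longrightarrow> fval I e g u = fval I' e g u"
proof (induction t and u arbitrary: e and e)
  case (Con c ts us)
  have "map (val I e g) ts = map (val I' e g) ts" "map (fval I e g) us = map (fval I' e g) us"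
    using Con by auto
  moreover have "I c = I' c"
    using assms[of c] Con.prems by simp
  ultimately show ?case by (simp del: map_eq_conv)
next
  case (FCon c)
  then show ?case using assms[of c] by simp
qed auto

lemma val_ia_interp:
  "wf_tm (ia_arity None) t \<Longrightarrow> val (ia_interp F) e g t = val (ia_interp F') e g t"
proof (erule val_interp_cong(1)[rotated])
  show "ia_interp F c = ia_interp F' c" if "ia_arity None c \<noteq> None" for c
    using that by (cases c) (auto simp: fun_eq_iff)
qed

text \<open>
  Admissible definitions do not mention \<open>CcpC\<close>, so its value here is irrelevant.
\<close>

abbreviation ia_interp0 :: "ia_const interp" where
  "ia_interp0 \<equiv> ia_interp (\<lambda>_ _. 0)"

text \<open>Parameters are numbered from 1 and list positions from 0, hence \<open>i - 1\<close>. In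
  \<open>q\<close>, variable 0 is the recursion argument and variable \<open>k + 1\<close> the
  previous value; appending \<open>r\<close> at the end makes list positions and variable numbers
  agree.\<close>

fun def_interp :: "ia_def \<Rightarrow> nat list \<Rightarrow> (nat \<Rightarrow> nat) list \<Rightarrow> nat" where
  "def_interp (Explicit k l p) ts us = val ia_interp0 (\<lambda>i. ts ! (i - 1)) ((!) us) p"
| "def_interp (PrimRec k l p q) ts us =
    rec_nat (val ia_interp0 (\<lambda>i. tl ts ! (i - 1)) ((!) us) p)
      (\<lambda>y r. val ia_interp0 ((!) (y # tl ts @ [r])) ((!) us) q) (hd ts)"

lemma tame_ia_params:
  assumes "wf_tm (ia_arity None) p" "fv_tm p \<subseteq> NV ` {1..k} \<union> FV ` {..<l}"
  shows "tame (k, l) (\<lambda>ts us. val (ia_interp F) (\<lambda>i. ts ! (i - 1)) ((!) us) p)"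
proof (rule tame_val[OF tame_interp_ia assms(1)])
  show "ts ! (x - 1) \<in> set ts" if "length ts = k" "NV x \<in> fv_tm p" for ts :: "nat list" and x
  proof -
    have "x \<in> {1..k}"
      using that(2) assms(2) by auto
    then show ?thesis
      using that(1) by (intro nth_mem) auto
  qed
qed (use assms(2) in auto)

lemma tame_def_interp:
  assumes "def_admissible d"
  shows "tame (def_arity d) (def_interp d)"
proof (cases d)
  case (Explicit k l p)
  then have "wf_tm (ia_arity None) p" "fv_tm p \<subseteq> NV ` {1..k} \<union> FV ` {..<l}"
    using assms by auto
  then have "tame (k, l) (\<lambda>ts us. val ia_interp0 (\<lambda>i. ts ! (i - 1)) ((!) us) p)"
    by (rule tame_ia_params)
  moreover have "def_interp d = (\<lambda>ts us. val ia_interp0 (\<lambda>i. ts ! (i - 1)) ((!) us) p)"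
    by (simp add: Explicit fun_eq_iff)
  ultimately show ?thesis by (simp add: Explicit)
next
  case (PrimRec k l p q)
  then have wf: "wf_tm (ia_arity None) p" "fv_tm p \<subseteq> NV ` {1..k} \<union> FV ` {..<l}"
    "wf_tm (ia_arity None) q" "fv_tm q \<subseteq> NV ` {0..k + 1} \<union> FV ` {..<l}"
    using assms by auto
  have p: "tame (k, l) (\<lambda>ts us. val ia_interp0 (\<lambda>i. ts ! (i - 1)) ((!) us) p)"
    using wf(1,2) by (rule tame_ia_params)
  have "tame (Suc (Suc k), l) (\<lambda>ts us. val ia_interp0 ((!) ts) ((!) us) q)"
    using wf(3,4) by (intro tame_val[OF tame_interp_ia]) auto
  \<comment> \<open>\<open>tame_rec_nat\<close> supplies the previous value as the second argument,
    while \<open>q\<close> expects it as the last.\<close>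
  then have "tame (Suc (Suc k), l)
      (\<lambda>ts us. val ia_interp0 ((!) (hd ts # tl (tl ts) @ [hd (tl ts)])) ((!) us) q)"
  proof (rule tame_reindex[where h = "\<lambda>ts. hd ts # tl (tl ts) @ [hd (tl ts)]"])
    show "set (hd ts # tl (tl ts) @ [hd (tl ts)]) \<subseteq> set ts" if "length ts = Suc (Suc k)" for ts
      using that by (auto simp: length_Suc_conv)
  qed simp
  note rec = tame_rec_nat[OF p this]
  have "def_interp d = (\<lambda>ts us. rec_nat (val ia_interp0 (\<lambda>i. tl ts ! (i - 1)) ((!) us) p)
      (\<lambda>y r. val ia_interp0 ((!) (y # tl ts @ [r])) ((!) us) q) (hd ts))"
    unfolding PrimRec by (intro ext) (rule def_interp.simps)
  then show ?thesis
    using rec by (simp only: PrimRec def_arity.simps list.sel)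
qed

lemma tame_interp_ia_ccp:
  assumes "def_admissible d"
  shows "tame_interp (ia_arity (Some (def_arity d))) (ia_interp (def_interp d))"
proof -
  have "tame kl (ia_interp (def_interp d) c)" if "ia_arity (Some (def_arity d)) c = Some kl" for c kl
  proof (cases "c = CcpC")
    case True
    moreover have "ia_interp (def_interp d) CcpC = def_interp d"
      by (simp add: fun_eq_iff)
    ultimately show ?thesis
      using that tame_def_interp[OF assms] by simp
  next
    case False
    then have "ia_arity None c = Some kl"
      using that by (cases c) auto
    then show ?thesis
      using tame_interp_ia unfolding tame_interp_def by blast
  qed
  then show ?thesis
    unfolding tame_interp_def by blast
qed

section \<open>Verification of the axioms\<close>

lemma sg_simps: "sg 0 = 0" "sg (Suc n) = 1" "sgbar 0 = 1" "sgbar (Suc n) = 0"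
  by (simp_all add: sg_def sgbar_def)

text \<open>Division by 0 is included: the recursion for the remainder agrees with the convention
  \<open>a mod 0 = a\<close>, and likewise that for the quotient with
  \<open>a div 0 = 0\<close>.\<close>

lemma Suc_mod_eq: "Suc a mod b = Suc (a mod b) * sg (distance b (Suc (a mod b)))"
  by (auto simp: mod_Suc sg_def distance_def)

lemma Suc_div_eq: "Suc a div b = a div b + sgbar (distance b (Suc (a mod b)))"
proof (cases "b = 0")
  case False
  then have "a mod b < b" by simp
  then show ?thesis by (auto simp: div_Suc mod_Suc sgbar_def distance_def)
qed (simp add: sgbar_def distance_def)

lemma min_eq_diff: "min a b = b - (b - a)" for a b :: nat
  by linarith

lemma max_eq_diff: "max a b = a - b + b" for a b :: nat
  by linarith

lemma Min_image_atMost_Suc: "Min (u ` {..Suc b}) = min (Min (u ` {..b})) (u (Suc b))"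
  for u :: "nat \<Rightarrow> nat"
  by (subst min.commute) (simp add: atMost_Suc)

lemma Max_image_atMost_Suc: "Max (u ` {..Suc b}) = max (Max (u ` {..b})) (u (Suc b))"
  for u :: "nat \<Rightarrow> nat"
  by (subst max.commute) (simp add: atMost_Suc)

lemma val_ia_mu:
  assumes "t \<noteq> y" "NV t \<notin> fv_tm r"
  shows "val (ia_interp F) e g (ia_mu t y b r) =
    bounded_mu (\<lambda>v. val (ia_interp F) (e(y := v)) g r) (val (ia_interp F) e g b)"
proof -
  have "val (ia_interp F) (e(t := a, y := v)) g r = val (ia_interp F) (e(y := v)) g r" for a v
    using assms by (subst fun_upd_twist) (auto simp: val_fun_upd_fresh)
  then show ?thesis
    by (simp add: ia_mu_def bounded_mu_def fun_upd_same del: fun_upd_apply prod.lessThan_Suc)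
qed

lemma val_ia_prime_above:
  assumes "NV c \<notin> fv_tm b"
  shows "val (ia_interp F) e g (ia_prime_above c p b) =
    (Suc (val (ia_interp F) e g p) - val (ia_interp F) e g b) +
    distance (\<Sum>v<val (ia_interp F) e g b. sgbar (val (ia_interp F) e g b mod Suc v)) 2"
  using assms
  by (simp add: ia_prime_above_def val_fun_upd_fresh fun_upd_same numeral_2_eq_2 del: fun_upd_apply)

text \<open>It settles the freshness condition of \<open>val_ia_mu\<close> in the equation for
  \<open>PrimeC\<close>.\<close>

lemma fv_tm_ia_prime_above:
  "fv_tm (ia_prime_above c p b) = fv_tm p \<union> fv_tm b \<union> (fv_tm b - {NV c})"
  by (auto simp: ia_prime_above_def)

lemma valid_ia_def_eqs: "A \<in> ia_def_eqs \<Longrightarrow> valid (ia_interp F) A"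
  unfolding ia_def_eqs_def Let_def
  by (elim insertE emptyE)
    (simp_all add: valid_def val_ia_mu val_ia_prime_above fv_tm_ia_prime_above sg_simps
      Suc_mod_eq Suc_div_eq min_eq_diff max_eq_diff Min_image_atMost_Suc Max_image_atMost_Suc
      factorial_def expt_def lh_def distance_def)

lemma val_ccp_app:
  assumes "length ts = fst (def_arity d)"
  shows "val (ia_interp F) e g (ccp_app d ts) =
    F (map (val (ia_interp F) e g) ts) (map g [0..<snd (def_arity d)])"
  unfolding ccp_app_def by (subst val_capp) (use assms in \<open>simp_all add: comp_def\<close>)

lemma fv_tm_ccp_app:
  assumes "length ts = fst (def_arity d)" "NV x \<in> fv_tm (ccp_app d ts)"
  shows "\<exists>t\<in>set ts. NV x \<in> fv_tm t"
  using assms by (cases ts) (auto simp: ccp_app_def capp_def split: if_splits)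

text \<open>\<open>p\<close> contains no \<open>CcpC\<close> and only the listed parameters, so
  interpretation and assignment may be exchanged at once: from the model under consideration to
  \<open>ia_interp0\<close>, from a global assignment to lists of arguments.\<close>

lemma val_param_cong:
  assumes "wf_tm (ia_arity None) p" "fv_tm p \<subseteq> NV ` X \<union> FV ` {..<l}"
    and "\<And>x. x \<in> X \<Longrightarrow> e x = e' x"
  shows "val (ia_interp F) e g p = val (ia_interp F') e' ((!) (map g [0..<l])) p"
proof -
  have "val (ia_interp F) e g p = val (ia_interp F) e' ((!) (map g [0..<l])) p"
    using assms(2,3) by (intro val_cong(1)) auto
  then show ?thesis
    using val_ia_interp[OF assms(1)] by metis
qed

lemma valid_def_eqs:
  assumes "def_admissible d" "A \<in> def_eqs d"
  shows "valid (ia_interp (def_interp d)) A"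
proof (cases d)
  case (Explicit k l p)
  then have wf: "wf_tm (ia_arity None) p" "fv_tm p \<subseteq> NV ` {1..k} \<union> FV ` {..<l}"
    using assms by auto
  have A: "A = Eq (ccp_app d (map NVar [1..<Suc k])) p"
    using assms Explicit by simp
  have "val (ia_interp (def_interp d)) e g p = def_interp d (map e [1..<Suc k]) (map g [0..<l])" for e g
    unfolding Explicit def_interp.simps
    by (rule val_param_cong[OF wf]) (auto simp del: upt_Suc)
  then show ?thesis
    using Explicit by (simp add: A valid_def val_ccp_app comp_def del: upt_Suc def_interp.simps)
next
  case (PrimRec k l p q)
  let ?xs = "map NVar [1..<Suc k] :: ia_tm list"
  let ?I = "ia_interp (def_interp d)"
  have wf: "wf_tm (ia_arity None) p" "fv_tm p \<subseteq> NV ` {1..k} \<union> FV ` {..<l}"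
    "wf_tm (ia_arity None) q" "fv_tm q \<subseteq> NV ` {0..k + 1} \<union> FV ` {..<l}"
    "free_for_tm (NV (k + 1)) (NV ` {0..k}) q"
    using assms PrimRec by auto
  have app: "val ?I e g (ccp_app d (t # ?xs)) =
      def_interp d (val ?I e g t # map e [1..<Suc k]) (map g [0..<l])" for e g t
    using PrimRec by (simp add: val_ccp_app comp_def del: upt_Suc def_interp.simps)
  have p: "val ?I e g p = def_interp d (0 # map e [1..<Suc k]) (map g [0..<l])" for e g
    unfolding PrimRec def_interp.simps list.sel nat.rec(1)
    by (rule val_param_cong[OF wf(1,2)]) (auto simp del: upt_Suc)
  have q: "val ?I e g (sbn_tm (k + 1) (ccp_app d (NVar 0 # ?xs)) q) =
      def_interp d (Suc (e 0) # map e [1..<Suc k]) (map g [0..<l])" for e g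
  proof -
    let ?r = "def_interp d (e 0 # map e [1..<Suc k]) (map g [0..<l])"
    \<comment> \<open>The number variables of the substituted term are among those that
      admissibility keeps from being captured in \<open>q\<close>.\<close>
    have "NV y \<in> NV ` {0..k}" if "NV y \<in> fv_tm (ccp_app d (NVar 0 # ?xs))" for y
      using fv_tm_ccp_app[OF _ that] PrimRec by (auto simp del: upt_Suc)
    then have "val ?I e g (sbn_tm (k + 1) (ccp_app d (NVar 0 # ?xs)) q) =
        val ?I (e(k + 1 := val ?I e g (ccp_app d (NVar 0 # ?xs)))) g q"
      using wf(5) by (rule val_sbn_tm)
    also have "\<dots> = val ?I (e(k + 1 := ?r)) g q"
      by (simp only: app val.simps)
    \<comment> \<open>Variable \<open>k + 1\<close> now holds the previous value, which is the last
      entry of the list.\<close>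
    also have "\<dots> = val ia_interp0 ((!) (e 0 # map e [1..<Suc k] @ [?r])) ((!) (map g [0..<l])) q"
    proof (rule val_param_cong[OF wf(3,4)])
      fix x
      assume "x \<in> {0..k + 1}"
      then consider "x = 0" | i where "x = Suc i" "i < k" | "x = k + 1"
        by (cases x) (auto simp: le_less)
      then show "(e(k + 1 := ?r)) x = (e 0 # map e [1..<Suc k] @ [?r]) ! x"
        by cases (simp_all add: nth_append del: upt_Suc def_interp.simps)
    qed
    also have "\<dots> = def_interp d (Suc (e 0) # map e [1..<Suc k]) (map g [0..<l])"
      unfolding PrimRec by simp
    finally show ?thesis .
  qed
  have "A = Eq (ccp_app d (Zero # ?xs)) p \<or>
     A = Eq (ccp_app d (ia_suc (NVar 0) # ?xs)) (sbn_tm (k + 1) (ccp_app d (NVar 0 # ?xs)) q)"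
    using assms PrimRec by (simp add: Let_def)
  then show ?thesis
    by (elim disjE) (simp_all only: valid_def sat.simps app p q val.simps fval.simps
      ia_interp.simps nth_Cons_0 simp_thms)
qed

lemma valid_IA1_axioms:
  assumes "def_admissible d" "A \<in> IA1_axioms d"
  shows "valid (ia_interp (def_interp d)) A"
proof -
  have "valid (ia_interp F) B" if "B \<in> induction_schema (FCon SucC)" for B F
    by (rule valid_induction_schema[OF that]) auto
  moreover have "valid (ia_interp F) B"
    if "B \<in> {Imp (Eq (ia_suc (NVar 0)) (ia_suc (NVar 1))) (Eq (NVar 0) (NVar 1)),
      Not (Eq (ia_suc (NVar 0)) Zero), Eq (NVar 0) (NVar 0),
      Imp (Eq (NVar 0) (NVar 1)) (Imp (Eq (NVar 0) (NVar 2)) (Eq (NVar 1) (NVar 2))),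
      Imp (Eq (NVar 0) (NVar 1)) (Eq (ia_suc (NVar 0)) (ia_suc (NVar 1))),
      Imp (Eq (NVar 0) (NVar 1)) (Eq (App (FVar 0) (NVar 0)) (App (FVar 0) (NVar 1)))}" for B F
    using that by (auto simp: valid_def)
  ultimately show ?thesis
    using assms valid_ia_def_eqs valid_def_eqs valid_lambda_conversion
    unfolding IA1_axioms_def Let_def Un_iff by metis
qed

theorem theorem3p6:
  shows "(\<not> (\<forall>A \<in> QF_AC00 ha_arity. HA1_proves A)) \<and>
    (\<forall>ccp. def_admissible ccp \<longrightarrow>
      \<not> (\<forall>A \<in> QF_AC00 (ia_arity (Some (def_arity ccp))). IA1_proves ccp A))"
  using not_proves_QF_AC00[OF tame_ha_interp valid_HA1_axioms]
    not_proves_QF_AC00[OF tame_interp_ia_ccp valid_IA1_axioms]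
  by blast

end
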